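(* Let $a,b\ge 2$ be multiplicatively independent integers, and fix an integer $N\ge 0$. Let $(W_n)_{n\ge 1}$ be an integer sequence satisfying a constant-coefficient linear recurrence such that $$W_n\mid a^{n+N}-1\qquad\text{and}\qquad W_n\mid b^{n+N}-1\qquad\text{for all } n\ge 1.$$ Then $(W_n)_{n\ge 1}$ is eventually periodic. If moreover $(W_n)_{n\ge 1}$ satisfies a recurrence with nonzero trailing coefficient, then it is periodic from the first term.
   Context: Positive integers $a$ and $b$ are multiplicatively dependent if $a^u=b^v$ for some positive integers $u,v$; otherwise they are multiplicatively independent. A sequence $(u_n)_{n\ge 1}$ of integers satisfies a constant-coefficient linear recurrence if there exist an integer $d\ge 1$ and integers $c_1,\dots,c_d$ such that $u_{n+d}=c_1u_{n+d-1}+\cdots+c_du_n$ for all $n\ge 1$; here the trailing coefficient $c_d$ is allowed to be zero. The sequence satisfies a recurrence with nonzero trailing coefficient if such a relation (with integer coefficients, valid for all $n\ge 1$) can be chosen with $c_d\ne 0$. A sequence $(u_n)_{n\ge 1}$ is eventually periodic if there are integers $M\ge 1$ and $n_0\ge 1$ with $u_{n+M}=u_n$ for all $n\ge n_0$; it is periodic (from the first term) if one can take $n_0=1$. *)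

theory Defs
  imports Main
begin

text \<open>Sequences \<open>(u\<^sub>n)\<close> with \<open>n \<ge> 1\<close> are functions on \<open>nat\<close>; the value at \<open>0\<close> is junk, and no
  definition below refers to it.\<close>

definition mult_dependent :: "nat \<Rightarrow> nat \<Rightarrow> bool" where
  "mult_dependent a b \<longleftrightarrow> (\<exists>u\<ge>1. \<exists>v\<ge>1. a ^ u = b ^ v)"

abbreviation mult_independent :: "nat \<Rightarrow> nat \<Rightarrow> bool" where
  "mult_independent a b \<equiv> \<not> mult_dependent a b"

text \<open>Only \<open>c 1, \<dots>, c d\<close> matter; since \<open>i \<le> d\<close>, the subtraction is not truncated.\<close>

definition satisfies_rec :: "nat \<Rightarrow> (nat \<Rightarrow> int) \<Rightarrow> (nat \<Rightarrow> int) \<Rightarrow> bool" where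
  "satisfies_rec d c u \<longleftrightarrow> d \<ge> 1 \<and> (\<forall>n\<ge>1. u (n + d) = (\<Sum>i=1..d. c i * u (n + d - i)))"

text \<open>The trailing coefficient \<open>c d\<close> may be zero here.\<close>

definition linear_recurrent :: "(nat \<Rightarrow> int) \<Rightarrow> bool" where
  "linear_recurrent u \<longleftrightarrow> (\<exists>d c. satisfies_rec d c u)"

definition linear_recurrent_nonzero_trailing :: "(nat \<Rightarrow> int) \<Rightarrow> bool" where
  "linear_recurrent_nonzero_trailing u \<longleftrightarrow> (\<exists>d c. satisfies_rec d c u \<and> c d \<noteq> 0)"

definition periodic_from :: "nat \<Rightarrow> (nat \<Rightarrow> int) \<Rightarrow> bool" where
  "periodic_from n0 u \<longleftrightarrow> (\<exists>M\<ge>1. \<forall>n\<ge>n0. u (n + M) = u n)"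

definition eventually_periodic :: "(nat \<Rightarrow> int) \<Rightarrow> bool" where
  "eventually_periodic u \<longleftrightarrow> (\<exists>n0\<ge>1. periodic_from n0 u)"

end

theory Submission
  imports
    Defs
    "Jordan_Normal_Form.Char_Poly"
    "HOL-Computational_Algebra.Field_as_Ring"
    "HOL-Computational_Algebra.Fundamental_Theorem_Algebra"
    "HOL-Number_Theory.Number_Theory"
    "HOL-Analysis.Harmonic_Numbers"
    "HOL-Real_Asymp.Real_Asymp"
begin

text \<open>
  The heart of the matter is that \<open>W\<close> cannot grow exponentially. For a
  single exponent \<open>m\<close>, bounding \<open>gcd (a ^ m - 1) (b ^ m - 1)\<close> subexponentially needs the subspace
  theorem; on average over many exponents an interpolation determinant suffices. Take the
  \<open>K = s\<^sup>2\<close> nodes \<open>a ^ i * b ^ j\<close> with \<open>i, j < s\<close>, which are distinct by multiplicative independence.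
  Their Vandermonde determinant is a nonzero integer of size \<open>exp (O(s K\<^sup>2)) = exp (O(s\<^sup>5))\<close>. If \<open>w\<close> divides
  both \<open>a ^ m - 1\<close> and \<open>b ^ m - 1\<close>, every node \<open>x\<close> satisfies \<open>x ^ m \<equiv> 1\<close> modulo \<open>w\<close>, so the columns are
  periodic modulo \<open>w\<close> with period \<open>m\<close> and \<open>w ^ (K - m)\<close> divides the determinant. Hence the least
  common multiple of all such \<open>w\<close> with \<open>m \<le> K / 2\<close> is at most \<open>exp (O(s\<^sup>3))\<close>
  (\<open>Lcm_power_le\<close>, \<open>Lcm_le_exp_cube\<close>).

  Two such divisors \<open>w\<close>, \<open>w'\<close> at \<open>m\<close>, \<open>m'\<close> have a greatest common divisor of at most
  \<open>a ^ gcd m m'\<close>, and \<open>gcd m m'\<close> is small on average over the pairs from a short interval. If every window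
  of \<open>r\<close> consecutive terms of \<open>W\<close> contained one of size at least \<open>\<rho> ^ n\<close> with \<open>\<rho> > 1\<close>, then a large multiple of \<open>s\<close>
  neighbouring windows near \<open>n = s\<^sup>2 / 4\<close> would give a least common multiple exceeding that
  bound (\<open>small_values_on_windows\<close>).

  For a recurrence sequence this subexponential behaviour forces all exponential components to have
  ratio at most \<open>1\<close> in absolute value. A combination of shifts of \<open>W\<close> that obeys a recurrence with simple
  roots is therefore bounded; having bounded denominators, it takes finitely many values and is eventually
  periodic. Removing one irreducible factor of the characteristic polynomial at a time, \<open>W\<close> is seen to be
  annihilated by a power of \<open>E ^ M - 1\<close>, where \<open>E\<close> is the shift
  (\<open>annihilated_by_power_of_X_power_minus_1\<close>): on each residue class modulo \<open>M\<close> it is eventually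
  a polynomial.

  Finally, an integer-valued polynomial \<open>f\<close> with \<open>f t\<close> dividing \<open>a ^ (m + M * t) - 1\<close> is constant
  (\<open>integer_valued_polynomial_dividing_powers_constant\<close>), because by its periodicity modulo primes only
  primes from a fixed finite set divide its values. So \<open>W\<close> is eventually periodic, and a recurrence with
  nonzero trailing coefficient can be run backwards to extend the period to the first term.
\<close>

(* The bare names denote operations on the type of polynomials and on matrices of variable size below,
   not those of the polynomial-ring and module records and on matrices indexed by types. *)
hide_const (open) UnivPoly.up_ring.monom UnivPoly.up_ring.coeff Module.smult
  Finite_Cartesian_Product.mat Finite_Cartesian_Product.vec
no_notation vec_nth (infixl \<open>$\<close> 90)

section \<open>Interpolation determinants\<close>

definition vandermonde_mat :: "nat \<Rightarrow> (nat \<Rightarrow> int) \<Rightarrow> int mat" where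
  "vandermonde_mat K x = mat K K (\<lambda>(k, i). x k ^ i)"

lemma vandermonde_mat_carrier [simp]: "vandermonde_mat K x \<in> carrier_mat K K"
  by (simp add: vandermonde_mat_def)

text \<open>
  A linear relation between the columns is a nonzero polynomial of degree less than \<open>K\<close> that
  vanishes at all \<open>K\<close> nodes.
\<close>
lemma det_vandermonde_mat_nonzero:
  assumes inj: "inj_on x {..<K}"
  shows "det (vandermonde_mat K x) \<noteq> 0"
proof
  assume "det (vandermonde_mat K x) = 0"
  then obtain v where v: "v \<in> carrier_vec K" "v \<noteq> 0\<^sub>v K" "vandermonde_mat K x *\<^sub>v v = 0\<^sub>v K"
    using det_0_iff_vec_prod_zero[OF vandermonde_mat_carrier] by blast
  define p where "p = (\<Sum>i<K. monom (v $ i) i)"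
  have root: "poly p (x k) = 0" if "k < K" for k
  proof -
    have "(vandermonde_mat K x *\<^sub>v v) $ k = (\<Sum>i<K. x k ^ i * v $ i)"
      using that v(1) by (simp add: vandermonde_mat_def scalar_prod_def atLeast0LessThan)
    then show ?thesis
      using that v(3) by (simp add: p_def poly_sum poly_monom mult.commute)
  qed
  have cf: "coeff p i = v $ i" if "i < K" for i
    using that by (simp add: p_def coeff_sum)
  have "p \<noteq> 0"
  proof
    assume "p = 0"
    with cf have "v $ i = 0" if "i < K" for i using that by simp
    then have "v = 0\<^sub>v K" using v(1) by (intro eq_vecI) auto
    with v(2) show False by simp
  qed
  have "K > 0" using v(1,2) by (cases K) (auto intro!: eq_vecI)
  then have "degree p < K"
    unfolding p_def by (intro degree_lessI) (auto simp: coeff_sum)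
  moreover have "K \<le> degree p"
  proof -
    have "K = card (x ` {..<K})" using inj by (simp add: card_image)
    also have "\<dots> \<le> card {z. poly p z = 0}"
      using root by (intro card_mono poly_roots_finite[OF \<open>p \<noteq> 0\<close>]) auto
    also have "\<dots> \<le> degree p" by (rule card_poly_roots_bound[OF \<open>p \<noteq> 0\<close>])
    finally show ?thesis .
  qed
  ultimately show False by simp
qed

text \<open>
  Modulo \<open>w\<close> the column of \<open>i\<close>-th powers agrees with that of \<open>(i - m)\<close>-th powers, because
  \<open>x ^ i - x ^ (i - m) = x ^ (i - m) * (x ^ m - 1)\<close>. Subtracting column \<open>i - m\<close> from column \<open>i\<close> for all \<open>i \<ge> m\<close>,
  that is, multiplying by a unitriangular matrix, leaves \<open>K - m\<close> columns divisible by \<open>w\<close>.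
  Arguing with columns instead of counting coincidences among the nodes treats composite \<open>w\<close> directly.
\<close>
lemma det_vandermonde_mat_divisible:
  fixes w :: int
  assumes "1 \<le> m" "m \<le> K" and dvd: "\<And>k. k < K \<Longrightarrow> w dvd x k ^ m - 1"
  shows "w ^ (K - m) dvd det (vandermonde_mat K x)"
proof -
  define B where "B = mat K K (\<lambda>(j, i). if j = i then 1 else if j + m = i then - 1 else 0 :: int)"
  have B: "B \<in> carrier_mat K K" by (simp add: B_def)
  define G where "G = vandermonde_mat K x * B"
  have G: "G \<in> carrier_mat K K"
    unfolding G_def by (rule mult_carrier_mat[OF vandermonde_mat_carrier B])
  have entry: "G $$ (k, i) = x k ^ (i - m) * (x k ^ m - 1)" if "k < K" "i < K" "m \<le> i" for k i
  proof -
    have "G $$ (k, i) = (\<Sum>j<K. x k ^ j * (if j = i then 1 else if j + m = i then - 1 else 0))"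
      using that by (simp add: G_def B_def vandermonde_mat_def scalar_prod_def atLeast0LessThan)
    also have "\<dots> = (\<Sum>j<K. (if j = i then x k ^ j else 0) + (if j = i - m then - (x k ^ j) else 0))"
      using that \<open>1 \<le> m\<close> by (intro sum.cong) auto
    also have "\<dots> = x k ^ i - x k ^ (i - m)"
      using that by (simp add: sum.distrib sum.delta)
    also have "\<dots> = x k ^ (i - m) * (x k ^ m - 1)"
      using that by (simp add: algebra_simps flip: power_add)
    finally show ?thesis .
  qed
  have "det B = prod_list (diag_mat B)"
    by (rule det_upper_triangular[OF _ B]) (auto simp: B_def)
  also have "diag_mat B = map (\<lambda>_. 1) [0..<K]"
    by (auto simp: diag_mat_def B_def)
  finally have "det B = 1" by (simp add: map_replicate_const prod_list_replicate)
  then have "det (vandermonde_mat K x) = det G"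
    by (simp add: G_def det_mult[OF vandermonde_mat_carrier B])
  \<comment> \<open>Transposed so that the divisible columns become rows, over which the Leibniz formula multiplies.\<close>
  also have "det G = det (transpose_mat G)" using det_transpose[OF G] by simp
  also have "\<dots> = (\<Sum>p\<in>{p. p permutes {0..<K}}. signof p * (\<Prod>i = 0..<K. transpose_mat G $$ (i, p i)))"
    using G by (intro det_def') simp
  also have "w ^ (K - m) dvd \<dots>"
  proof (intro dvd_sum dvd_mult)
    fix p assume "p \<in> {p. p permutes {0..<K}}"
    then have p: "p i < K" if "i < K" for i
      using that permutes_in_image[of p "{0..<K}" i] by simp
    have "w ^ (K - m) = (\<Prod>i\<in>{m..<K}. w)" by simp
    also have "\<dots> dvd (\<Prod>i\<in>{m..<K}. transpose_mat G $$ (i, p i))"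
      using p dvd G by (intro prod_dvd_prod) (auto simp: entry)
    also have "\<dots> dvd (\<Prod>i = 0..<K. transpose_mat G $$ (i, p i))"
      by (intro prod_dvd_prod_subset) auto
    finally show "w ^ (K - m) dvd (\<Prod>i = 0..<K. transpose_mat G $$ (i, p i))" .
  qed
  finally show ?thesis .
qed

lemma abs_det_vandermonde_mat_le:
  assumes x: "\<And>k. k < K \<Longrightarrow> 0 \<le> x k \<and> x k \<le> X" and "1 \<le> X"
  shows "\<bar>det (vandermonde_mat K x)\<bar> \<le> int K ^ K * X ^ (K * K)"
proof -
  have "\<bar>det (vandermonde_mat K x)\<bar> \<le>
    (\<Sum>p\<in>{p. p permutes {0..<K}}. \<bar>signof p * (\<Prod>i = 0..<K. vandermonde_mat K x $$ (i, p i))\<bar>)"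
    by (subst det_def'[OF vandermonde_mat_carrier]) (rule sum_abs)
  also have "\<dots> \<le> (\<Sum>p\<in>{p. p permutes {0..<K}}. X ^ (K * K))"
  proof (intro sum_mono)
    fix p assume "p \<in> {p. p permutes {0..<K}}"
    then have p: "p i < K" if "i < K" for i
      using that permutes_in_image[of p "{0..<K}" i] by simp
    have "\<bar>signof p * (\<Prod>i = 0..<K. vandermonde_mat K x $$ (i, p i))\<bar> = (\<Prod>i = 0..<K. x i ^ p i)"
      using p x by (simp add: abs_mult abs_prod sign_def vandermonde_mat_def prod_nonneg)
    also have "\<dots> \<le> (\<Prod>i = 0..<K. X ^ K)"
    proof (intro prod_mono conjI)
      fix i assume i: "i \<in> {0..<K}"
      show "0 \<le> x i ^ p i" using i x by simp
      have "x i ^ p i \<le> X ^ p i" using i x by (intro power_mono) auto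
      also have "\<dots> \<le> X ^ K" using i p[of i] \<open>1 \<le> X\<close> by (intro power_increasing) auto
      finally show "x i ^ p i \<le> X ^ K" .
    qed
    finally show "\<bar>signof p * (\<Prod>i = 0..<K. vandermonde_mat K x $$ (i, p i))\<bar> \<le> X ^ (K * K)"
      by (simp add: power_mult)
  qed
  also have "\<dots> = fact K * X ^ (K * K)"
    by (simp add: card_permutations)
  also have "\<dots> \<le> int K ^ K * X ^ (K * K)"
    using fact_le_power[of K, where 'a = int] \<open>1 \<le> X\<close> by (intro mult_right_mono) auto
  finally show ?thesis .
qed

section \<open>The least common multiple of common divisors of \<open>a ^ m - 1\<close> and \<open>b ^ m - 1\<close>\<close>

lemma mult_independent_powers_inj:
  assumes ab: "a \<ge> 2" "b \<ge> 2" "mult_independent a b" and eq: "a ^ i * b ^ j = a ^ i' * b ^ j'"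
  shows "i = i' \<and> j = j'"
proof -
  have *: "i = i' \<and> j = j'" if eq: "a ^ i * b ^ j = a ^ i' * b ^ j'" and le: "i \<le> i'" for i j i' j'
  proof -
    obtain d where d: "i' = i + d" using le le_Suc_ex by blast
    have e: "b ^ j = a ^ d * b ^ j'" using eq ab(1) by (simp add: d power_add)
    show ?thesis
    proof (cases "d = 0")
      case True
      then show ?thesis using e d ab(2) by simp
    next
      case False
      then have "a ^ d > 1" using ab(1) by (intro one_less_power) auto
      then have "b ^ j' < b ^ j" using e ab(2) by simp
      then have "j' < j" using ab(2) by simp
      then obtain f where f: "j = j' + f" "f \<ge> 1" using less_imp_add_positive[of j' j] by auto
      have "b ^ f = a ^ d" using e ab(2) by (simp add: f power_add)
      then show ?thesis using ab(3) False f(2) unfolding mult_dependent_def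
        by (metis One_nat_def Suc_leI neq0_conv)
    qed
  qed
  show ?thesis
    using *[of i j i' j'] *[of i' j' i j] eq by (cases "i \<le> i'") auto
qed

lemma lcm_power_dvd:
  fixes x y D :: nat
  assumes "x ^ e dvd D" "y ^ e dvd D"
  shows "lcm x y ^ e dvd D"
proof (cases "x = 0 \<and> y = 0")
  case False
  have "lcm x y ^ e * gcd x y ^ e = lcm (x ^ e) (y ^ e) * gcd (x ^ e) (y ^ e)"
    by (metis mult.commute power_mult_distrib prod_gcd_lcm_nat)
  then have "lcm x y ^ e = lcm (x ^ e) (y ^ e)"
    using False by simp
  then show ?thesis using assms by simp
qed (use assms in auto)

lemma Lcm_power_dvd:
  fixes w :: "'a \<Rightarrow> nat"
  assumes "finite S" "\<And>m. m \<in> S \<Longrightarrow> w m ^ e dvd D"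
  shows "Lcm (w ` S) ^ e dvd D"
  using assms by (induction S rule: finite_induct) (auto intro: lcm_power_dvd)

text \<open>
  The divisibility of the Vandermonde determinant of the nodes \<open>a ^ i * b ^ j\<close> by \<open>w m ^ (s * s - M)\<close>
  for every single \<open>m\<close> passes to the least common multiple, since taking powers commutes
  with least common multiples. As the determinant is nonzero, its size bounds the divisor.
\<close>
lemma Lcm_power_le:
  fixes w :: "nat \<Rightarrow> nat"
  assumes ab: "a \<ge> 2" "b \<ge> 2" "mult_independent a b"
    and S: "finite S" "\<And>m. m \<in> S \<Longrightarrow> 1 \<le> m \<and> m \<le> M" and M: "M \<le> s * s"
    and dvd: "\<And>m. m \<in> S \<Longrightarrow> int (w m) dvd int a ^ m - 1" "\<And>m. m \<in> S \<Longrightarrow> int (w m) dvd int b ^ m - 1"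
  shows "Lcm (w ` S) ^ (s * s - M) \<le> (s * s) ^ (s * s) * ((a * b) ^ s) ^ ((s * s) * (s * s))"
proof -
  define K where "K = s * s"
  \<comment> \<open>The pairs of exponents \<open>(i, j)\<close> with \<open>i, j < s\<close> are numbered by \<open>k = i * s + j\<close>.\<close>
  define x where "x = (\<lambda>k. int (a ^ (k div s) * b ^ (k mod s)))"
  have inj: "inj_on x {..<K}"
  proof (rule inj_onI)
    fix k l assume "x k = x l"
    then have "a ^ (k div s) * b ^ (k mod s) = a ^ (l div s) * b ^ (l mod s)"
      unfolding x_def by (simp only: of_nat_eq_iff)
    from mult_independent_powers_inj[OF ab this] show "k = l"
      by (metis div_mult_mod_eq)
  qed
  define D where "D = nat \<bar>det (vandermonde_mat K x)\<bar>"
  have D: "D > 0" using det_vandermonde_mat_nonzero[OF inj] by (simp add: D_def)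
  have x_bound: "0 \<le> x k \<and> x k \<le> int ((a * b) ^ s)" if "k < K" for k
  proof -
    have s: "s > 0" using that by (cases s) (auto simp: K_def)
    have "k div s < s" using that s by (simp add: K_def less_mult_imp_div_less)
    then have "a ^ (k div s) * b ^ (k mod s) \<le> a ^ s * b ^ s"
      using s ab by (intro mult_mono power_increasing) (auto simp: less_imp_le)
    then show ?thesis unfolding x_def power_mult_distrib by (simp only: of_nat_le_iff) simp
  qed
  have "w m ^ (K - M) dvd D" if m: "m \<in> S" for m
  proof -
    have "int (w m) dvd x k ^ m - 1" for k
    proof -
      have "[int a ^ m = 1] (mod int (w m))" "[int b ^ m = 1] (mod int (w m))"
        using dvd[OF m] by (simp_all add: cong_iff_dvd_diff)
      then have "[(int a ^ m) ^ (k div s) * (int b ^ m) ^ (k mod s) = 1 ^ (k div s) * 1 ^ (k mod s)] (mod int (w m))"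
        by (intro cong_mult cong_pow)
      moreover have "(int a ^ m) ^ (k div s) * (int b ^ m) ^ (k mod s) = x k ^ m"
        by (simp add: x_def power_mult_distrib mult.commute flip: power_mult)
      ultimately show ?thesis by (simp add: cong_iff_dvd_diff)
    qed
    then have "int (w m) ^ (K - m) dvd det (vandermonde_mat K x)"
      using S(2)[OF m] M by (intro det_vandermonde_mat_divisible) (auto simp: K_def)
    then have "int (w m) ^ (K - M) dvd det (vandermonde_mat K x)"
      using S(2)[OF m] by (elim dvd_trans[rotated], intro le_imp_power_dvd) auto
    then show ?thesis
      by (simp add: D_def flip: of_nat_power)
  qed
  then have "Lcm (w ` S) ^ (K - M) dvd D"
    by (intro Lcm_power_dvd[OF S(1)])
  then have "Lcm (w ` S) ^ (K - M) \<le> D" using D by (rule dvd_imp_le)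
  also have "int D \<le> int K ^ K * int ((a * b) ^ s) ^ (K * K)"
  proof -
    have "1 \<le> (a * b) ^ s" using ab by (simp add: Suc_le_eq)
    then have "1 \<le> int ((a * b) ^ s)" by (metis of_nat_1 of_nat_mono)
    from abs_det_vandermonde_mat_le[OF x_bound this] show ?thesis by (simp add: D_def)
  qed
  then have "D \<le> K ^ K * ((a * b) ^ s) ^ (K * K)"
    by (simp only: of_nat_le_iff flip: of_nat_power of_nat_mult)
  finally show ?thesis by (simp add: K_def)
qed

text \<open>
  The preceding bound with \<open>s = 2 * u\<close> and \<open>M = s * s / 2\<close>, after extracting \<open>M\<close>-th roots. The
  exponents \<open>m\<close> range up to order \<open>u\<^sup>2\<close>, so numbers \<open>w m\<close> of exponential size that were close to coprime would
  give a left-hand side of size \<open>exp (c * u\<^sup>4)\<close>; about \<open>u\<close> of them suffice to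
  reach the order \<open>exp (c * u\<^sup>3)\<close> of the right-hand side.
\<close>
lemma Lcm_le_exp_cube:
  fixes w :: "nat \<Rightarrow> nat"
  assumes ab: "a \<ge> 2" "b \<ge> 2" "mult_independent a b" and u: "u \<ge> 1"
    and S: "finite S" "\<And>m. m \<in> S \<Longrightarrow> 1 \<le> m \<and> m \<le> 2 * u ^ 2"
    and dvd: "\<And>m. m \<in> S \<Longrightarrow> int (w m) dvd int a ^ m - 1" "\<And>m. m \<in> S \<Longrightarrow> int (w m) dvd int b ^ m - 1"
  shows "Lcm (w ` S) \<le> 16 * u ^ 4 * (a * b) ^ (16 * u ^ 3)"
proof -
  define M where "M = 2 * u ^ 2"
  have K: "2 * u * (2 * u) = 2 * M" by (simp add: M_def power2_eq_square)
  have "Lcm (w ` S) ^ (2 * M - M) \<le> (2 * M) ^ (2 * M) * ((a * b) ^ (2 * u)) ^ ((2 * M) * (2 * M))"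
    using Lcm_power_le[OF ab S(1), of M "2 * u" w] S(2) dvd K unfolding M_def by simp
  also have "(2 * M) ^ (2 * M) = (16 * u ^ 4) ^ M"
    unfolding power_mult by (simp add: M_def power_mult_distrib flip: power_mult)
  also have "2 * u * (2 * M * (2 * M)) = 16 * u ^ 3 * M"
    by (simp add: M_def power2_eq_square power3_eq_cube)
  then have "((a * b) ^ (2 * u)) ^ ((2 * M) * (2 * M)) = ((a * b) ^ (16 * u ^ 3)) ^ M"
    by (simp only: flip: power_mult)
  also have "(16 * u ^ 4) ^ M * \<dots> = (16 * u ^ 4 * (a * b) ^ (16 * u ^ 3)) ^ M"
    by (simp only: power_mult_distrib)
  finally have "Lcm (w ` S) ^ M \<le> (16 * u ^ 4 * (a * b) ^ (16 * u ^ 3)) ^ M" by simp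
  moreover have "M > 0" using u by (simp add: M_def)
  ultimately show ?thesis by (simp only: power_mono_iff[OF le0 le0])
qed

section \<open>Few large values in short windows\<close>

lemma gcd_lcm_dvd:
  fixes c x y :: nat
  shows "gcd c (lcm x y) dvd gcd c x * gcd c y"
proof -
  have xy: "lcm x y dvd x * y" by simp
  have "gcd c (lcm x y) dvd gcd (c * y) (x * y)"
    using xy dvd_trans[OF gcd_dvd2 xy] by (simp add: dvd_mult2)
  also have "gcd (c * y) (x * y) = gcd c x * y"
    by (metis gcd_mult_distrib_nat mult.commute)
  finally have "gcd c (lcm x y) dvd gcd (gcd c x * c) (gcd c x * y)" by simp
  then show ?thesis by (simp add: gcd_mult_distrib_nat)
qed

text \<open>
  A lower bound for the least common multiple of numbers whose pairwise greatest common divisors are small.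
  Running over ordered pairs only squares the product of these divisors and keeps the formula symmetric.
\<close>
lemma prod_dvd_Lcm_mult_gcds:
  fixes w :: "'a \<Rightarrow> nat"
  assumes "finite S"
  shows "(\<Prod>x\<in>S. w x) dvd Lcm (w ` S) * (\<Prod>x\<in>S. \<Prod>y\<in>S - {x}. gcd (w x) (w y))"
  using assms
proof (induction S rule: finite_induct)
  case (insert z S)
  let ?P = "\<lambda>S. \<Prod>x\<in>S. \<Prod>y\<in>S - {x}. gcd (w x) (w y)"
  have gcd_Lcm: "gcd c (Lcm (w ` T)) dvd (\<Prod>y\<in>T. gcd c (w y))" if "finite T" for c T
    using that
  proof (induction T rule: finite_induct)
    case (insert t T)
    have "gcd c (Lcm (w ` insert t T)) dvd gcd c (w t) * gcd c (Lcm (w ` T))"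
      using gcd_lcm_dvd[of c "w t" "Lcm (w ` T)"] by simp
    also have "\<dots> dvd gcd c (w t) * (\<Prod>y\<in>T. gcd c (w y))"
      using insert.IH by (intro mult_dvd_mono) auto
    finally show ?case using insert by simp
  qed simp
  have "(\<Prod>x\<in>insert z S. w x) dvd w z * (Lcm (w ` S) * ?P S)"
    using insert by simp
  also have "\<dots> = Lcm (w ` insert z S) * gcd (w z) (Lcm (w ` S)) * ?P S"
    using prod_gcd_lcm_nat[of "w z" "Lcm (w ` S)"] by (simp add: algebra_simps)
  also have "\<dots> dvd Lcm (w ` insert z S) * (\<Prod>y\<in>S. gcd (w z) (w y)) * ?P S"
    using gcd_Lcm[OF insert(1)] by (intro mult_dvd_mono) auto
  also have "(\<Prod>y\<in>S. gcd (w z) (w y)) * ?P S dvd ?P (insert z S)"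
  proof -
    have "insert z S - {z} = S" using insert by auto
    moreover have "?P S dvd (\<Prod>x\<in>S. \<Prod>y\<in>insert z S - {x}. gcd (w x) (w y))"
      using insert by (intro prod_dvd_prod prod_dvd_prod_subset) auto
    ultimately show ?thesis using insert by simp
  qed
  then have "Lcm (w ` insert z S) * (\<Prod>y\<in>S. gcd (w z) (w y)) * ?P S dvd
      Lcm (w ` insert z S) * ?P (insert z S)"
    by (simp add: mult.assoc)
  finally show ?case .
qed simp

text \<open>
  A common divisor of \<open>a ^ m - 1\<close> and \<open>a ^ n - 1\<close> divides \<open>a ^ gcd m n - 1\<close>, since the order of
  \<open>a\<close> modulo that divisor divides both exponents.
\<close>
lemma gcd_le_power_gcd:
  fixes x y :: nat
  assumes a: "a \<ge> 2" and m: "m \<ge> 1" and "int x dvd int a ^ m - 1" "int y dvd int a ^ n - 1"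
  shows "gcd x y \<le> a ^ gcd m n"
proof -
  define g where "g = gcd x y"
  have "int g dvd int a ^ m - 1" "int g dvd int a ^ n - 1"
    using assms(3,4) by (auto simp: g_def intro: dvd_trans[rotated])
  then have "[int a ^ m = 1] (mod int g)" "[int a ^ n = 1] (mod int g)"
    by (simp_all add: cong_iff_dvd_diff)
  then have "[a ^ m = 1] (mod g)" "[a ^ n = 1] (mod g)"
    by (metis cong_int_iff of_nat_1 of_nat_power)+
  then have "[a ^ gcd m n = 1] (mod g)" by (simp only: ord_divides gcd_greatest_iff)
  then have "g dvd a ^ gcd m n - 1" using a by (simp add: cong_altdef_nat)
  moreover have "a ^ gcd m n > 1" using a m by (intro one_less_power) auto
  ultimately have "g \<le> a ^ gcd m n - 1" by (intro dvd_imp_le) auto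
  then show ?thesis by (simp add: g_def)
qed

lemma card_multiples_le:
  assumes "1 \<le> g" "g \<le> H"
  shows "g * card {x\<in>{P..<P + H}. g dvd x} \<le> 3 * H"
proof -
  have "card {x\<in>{P..<P + H}. g dvd x} = card ((\<lambda>x. x div g) ` {x\<in>{P..<P + H}. g dvd x})"
    by (intro card_image[symmetric] inj_onI) (metis dvd_div_mult_self mem_Collect_eq)
  also have "\<dots> \<le> card {P div g..P div g + H div g + 1}"
  proof (intro card_mono image_subsetI)
    fix x assume "x \<in> {x\<in>{P..<P + H}. g dvd x}"
    then have "P \<le> x" "x \<le> P + H" by auto
    then have "P div g \<le> x div g" "x div g \<le> (P + H) div g" by (auto intro: div_le_mono)
    moreover have "(P + H) div g \<le> P div g + H div g + 1"
    proof -
      have "P mod g + H mod g < g * 2"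
        using mod_less_divisor[of g P] mod_less_divisor[of g H] assms by linarith
      then have "(P mod g + H mod g) div g \<le> 1"
        using less_mult_imp_div_less[of "P mod g + H mod g" 2 g] by (simp add: mult.commute)
      then show ?thesis using div_add1_eq[of P H g] by simp
    qed
    ultimately show "x div g \<in> {P div g..P div g + H div g + 1}" by auto
  qed simp
  also have "\<dots> = H div g + 2" by simp
  finally have "g * card {x\<in>{P..<P + H}. g dvd x} \<le> g * (H div g + 2)"
    by (rule mult_le_mono2)
  also have "\<dots> \<le> H + 2 * g" by (simp add: algebra_simps)
  finally show ?thesis using assms by simp
qed

text \<open>
  The trivial estimate \<open>gcd x y < H\<close> would give \<open>H\<^sup>3\<close>, which is of the same order as the gain in
  \<open>small_values_on_windows\<close>. Bounding \<open>gcd x y\<close> by the sum of all common divisors \<open>g\<close> and counting multiples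
  of \<open>g\<close> in the interval replaces one factor \<open>H\<close> by a logarithm.
\<close>
lemma sum_gcd_le:
  assumes "S \<subseteq> {P..<P + H}" "P \<ge> 1"
  shows "real (\<Sum>x\<in>S. \<Sum>y\<in>S - {x}. gcd x y) \<le> 9 * real H ^ 2 * harm H"
proof -
  let ?I = "{P..<P + H}"
  let ?f = "\<lambda>x y. \<Sum>g = 1..H. if g dvd x \<and> g dvd y then g else 0"
  have fin: "finite S" using assms(1) finite_subset by blast
  \<comment> \<open>The greatest common divisor of two distinct elements divides their difference, so it occurs among the \<open>g \<le> H\<close>.\<close>
  have le: "gcd x y \<le> ?f x y" if "x \<in> S" "y \<in> S - {x}" for x y
  proof -
    have "gcd x y \<le> H"
    proof -
      have "gcd x y dvd (if x < y then y - x else x - y)" by (auto intro: dvd_diff_nat)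
      then have "gcd x y \<le> (if x < y then y - x else x - y)"
        by (rule dvd_imp_le) (use that in auto)
      also have "\<dots> \<le> H" using that subsetD[OF assms(1), of x] subsetD[OF assms(1), of y] by auto
      finally show ?thesis .
    qed
    moreover have "gcd x y \<ge> 1" using that assms by (auto simp: Suc_le_eq)
    ultimately have "?f x y \<ge> (\<Sum>g\<in>{gcd x y}. if g dvd x \<and> g dvd y then g else 0)"
      by (intro sum_mono2) auto
    then show ?thesis by simp
  qed
  have "(\<Sum>x\<in>S. \<Sum>y\<in>S - {x}. gcd x y) \<le> (\<Sum>x\<in>S. \<Sum>y\<in>S - {x}. ?f x y)"
    by (intro sum_mono le)
  also have "\<dots> \<le> (\<Sum>x\<in>?I. \<Sum>y\<in>?I. ?f x y)"
  proof -
    have "(\<Sum>x\<in>S. \<Sum>y\<in>S - {x}. ?f x y) \<le> (\<Sum>x\<in>S. \<Sum>y\<in>?I. ?f x y)"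
      using assms(1) by (intro sum_mono sum_mono2) auto
    also have "\<dots> \<le> (\<Sum>x\<in>?I. \<Sum>y\<in>?I. ?f x y)"
      using assms(1) by (intro sum_mono2) auto
    finally show ?thesis .
  qed
  also have "\<dots> = (\<Sum>g = 1..H. \<Sum>x\<in>?I. \<Sum>y\<in>?I. if g dvd x \<and> g dvd y then g else 0)"
    by (subst sum.swap[of _ ?I "{1..H}"], rule sum.cong[OF refl], subst sum.swap[of _ ?I "{1..H}"], rule refl)
  also have "\<dots> = (\<Sum>g = 1..H. g * card {x\<in>?I. g dvd x} * card {x\<in>?I. g dvd x})"
  proof (intro sum.cong refl)
    fix g
    have "(\<Sum>x\<in>?I. \<Sum>y\<in>?I. if g dvd x \<and> g dvd y then g else 0) =
      (\<Sum>x\<in>?I. \<Sum>y\<in>?I. g * (of_bool (g dvd x) * of_bool (g dvd y)))"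
      by (intro sum.cong) auto
    also have "\<dots> = g * ((\<Sum>x\<in>?I. of_bool (g dvd x)) * (\<Sum>y\<in>?I. of_bool (g dvd y)))"
      by (simp only: sum_product) (simp only: sum_distrib_left)
    also have "(\<Sum>x\<in>?I. of_bool (g dvd x)) = card {x\<in>?I. g dvd x}"
      by (simp add: Int_def)
    finally show "(\<Sum>x\<in>?I. \<Sum>y\<in>?I. if g dvd x \<and> g dvd y then g else 0) =
      g * card {x\<in>?I. g dvd x} * card {x\<in>?I. g dvd x}" by (simp add: mult.assoc)
  qed
  finally have "real (\<Sum>x\<in>S. \<Sum>y\<in>S - {x}. gcd x y) \<le>
      real (\<Sum>g = 1..H. g * card {x\<in>?I. g dvd x} * card {x\<in>?I. g dvd x})"
    by (simp only: of_nat_le_iff)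
  also have "\<dots> \<le> (\<Sum>g = 1..H. 9 * real H ^ 2 * inverse (real g))"
    unfolding of_nat_sum
  proof (intro sum_mono)
    fix g assume g: "g \<in> {1..H}"
    define c where "c = card {x\<in>?I. g dvd x}"
    have gc: "g * c \<le> 3 * H" unfolding c_def using g by (intro card_multiples_le) auto
    have "(g * c) * (g * c) \<le> (3 * H) * (3 * H)" by (rule mult_mono[OF gc gc]) auto
    then have "real ((g * c) * (g * c)) \<le> real ((3 * H) * (3 * H))" by (simp only: of_nat_le_iff)
    then have "real g * (real g * real c * real c) \<le> 9 * real H ^ 2"
      by (simp add: power2_eq_square mult_ac)
    then have "real g * real c * real c \<le> 9 * real H ^ 2 * inverse (real g)"
      using g by (simp add: field_simps)
    then show "real (g * card {x\<in>?I. g dvd x} * card {x\<in>?I. g dvd x}) \<le> 9 * real H ^ 2 * inverse (real g)"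
      by (simp add: c_def)
  qed
  also have "\<dots> = 9 * real H ^ 2 * harm H"
    by (simp add: harm_def sum_distrib_left)
  finally show ?thesis .
qed

lemma harm_le_1_plus_ln: "n \<ge> 1 \<Longrightarrow> harm n \<le> 1 + ln (real n)"
  using decseqD[OF decseq_harm_diff_ln, of 0 "n - 1"] by (simp add: harm_Suc harm_def)

text \<open>
  The negation supplies, in every window of length \<open>r\<close> from \<open>n0\<close> on, a term larger than \<open>\<rho> ^ n\<close>. For a fixed
  large \<open>c\<close>, consider \<open>c * u\<close> consecutive windows starting at \<open>u\<^sup>2\<close>. The product of the selected
  terms exceeds \<open>\<rho> ^ (c * u\<^sup>3)\<close>, the pairwise greatest common divisors cost \<open>exp (O(u\<^sup>2 * ln u))\<close>, and their
  least common multiple is at most \<open>16 * u\<^sup>4 * (a * b) ^ (16 * u\<^sup>3)\<close>. This is absurd for large \<open>u\<close>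
  once \<open>\<rho> ^ c \<ge> (a * b) ^ 17\<close>.
\<close>
theorem small_values_on_windows:
  fixes W :: "nat \<Rightarrow> int" and \<rho> :: real
  assumes ab: "a \<ge> 2" "b \<ge> 2" "mult_independent a b"
    and Wa: "\<And>n. n \<ge> 1 \<Longrightarrow> W n dvd int a ^ (n + N) - 1"
    and Wb: "\<And>n. n \<ge> 1 \<Longrightarrow> W n dvd int b ^ (n + N) - 1"
    and \<rho>: "\<rho> > 1"
  shows "\<exists>n\<ge>n0. \<forall>k<r. \<bar>real_of_int (W (n + k))\<bar> \<le> \<rho> ^ n"
proof (rule ccontr)
  assume "\<not> ?thesis"
  then have "\<forall>n. \<exists>k. n \<ge> n0 \<longrightarrow> k < r \<and> \<bar>real_of_int (W (n + k))\<bar> > \<rho> ^ n"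
    by (metis not_le)
  then obtain \<kappa> where \<kappa>: "\<And>n. n \<ge> n0 \<Longrightarrow> \<kappa> n < r"
    "\<And>n. n \<ge> n0 \<Longrightarrow> \<bar>real_of_int (W (n + \<kappa> n))\<bar> > \<rho> ^ n" by metis
  have r: "r \<ge> 1" using \<kappa>(1)[of n0] by simp
  define A B where "A = ln (real a)" and "B = ln (real (a * b))"
  have A: "A > 0" using ab by (simp add: A_def)
  have "a * b \<ge> 2 * 2" using ab by (intro mult_mono) auto
  then have ab4: "a * b \<ge> 4" by simp
  then have "1 < real (a * b)" by linarith
  then have B: "B > 0" unfolding B_def by (rule ln_gt_zero)
  \<comment> \<open>Any constant above \<open>16\<close> would do: the excess over the exponent of \<open>a * b\<close> is what remains as \<open>u\<^sup>3 * B\<close> in \<open>key\<close>.\<close>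
  obtain c0 :: nat where c0: "real c0 * ln \<rho> \<ge> 17 * B"
    using \<rho> reals_Archimedean2[of "17 * B / ln \<rho>"] by (auto simp: field_simps intro: less_imp_le)
  define c where "c = Suc c0"
  have c: "c \<ge> 1" "real c * ln \<rho> \<ge> 17 * B"
    using c0 \<rho> by (auto simp: c_def algebra_simps intro: add_increasing)
  define R where "R = r * c"
  have R: "R \<ge> 1" using r c by (simp add: R_def)
  \<comment> \<open>Indexing by the exponent \<open>m = n + N\<close> instead of \<open>n\<close> absorbs the shift \<open>N\<close>.\<close>
  define w where "w m = nat \<bar>W (m - N)\<bar>" for m
  have key: "real u ^ 3 * B \<le> ln 16 + 4 * ln (real u) + 9 * (real R * real u) ^ 2 * (1 + ln (real R * real u)) * A"
    if u: "u \<ge> 1" "u ^ 2 \<ge> n0" "R * u + N \<le> u ^ 2" for u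
  proof -
    define t where "t j = u ^ 2 + j * r" for j
    have t: "t j \<ge> n0" "t j \<ge> u ^ 2" "t j \<ge> 1" for j
      using u(1,2) by (auto simp: t_def trans_le_add1)
    define h where "h j = t j + \<kappa> (t j) + N" for j
    have h_less: "h i < h j" if "i < j" for i j
    proof -
      have "h i < t i + r + N" using \<kappa>(1)[OF t(1)[of i]] by (simp add: h_def)
      also have "t i + r \<le> t j" using mult_le_mono1[of "Suc i" j r] that by (simp add: t_def)
      finally show ?thesis by (simp add: h_def)
    qed
    then have inj: "inj h" by (intro strict_mono_imp_inj_on strict_monoI)
    define S where "S = h ` {..<c * u}"
    define P H where "P = u ^ 2 + N" and "H = R * u"
    have finS: "finite S" by (simp add: S_def)
    have S_sub: "S \<subseteq> {P..<P + H}"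
    proof
      fix m assume "m \<in> S"
      then obtain j where j: "j < c * u" "m = h j" by (auto simp: S_def)
      have "Suc j * r \<le> c * u * r" using j by (intro mult_le_mono1) simp
      then have "j * r + r \<le> H" by (simp add: H_def R_def mult_ac)
      then show "m \<in> {P..<P + H}"
        using \<kappa>(1)[OF t(1)[of j]] by (simp add: j h_def t_def P_def)
    qed
    have P1: "P \<ge> 1" using u(1) by (simp add: P_def Suc_le_eq)
    have m_ge: "m - N \<ge> 1" "m - N + N = m" if "m \<in> S" for m
      using that t(3) by (auto simp: S_def h_def Suc_le_eq add_pos_nonneg)
    have dvd: "int (w m) dvd int a ^ m - 1" "int (w m) dvd int b ^ m - 1" if "m \<in> S" for m
      using Wa[OF m_ge(1)[OF that]] Wb[OF m_ge(1)[OF that]] m_ge(2)[OF that] by (simp_all add: w_def)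
    have big: "real (w m) > \<rho> ^ (u ^ 2)" if "m \<in> S" for m
    proof -
      obtain j where j: "m = h j" using \<open>m \<in> S\<close> by (auto simp: S_def)
      have "\<rho> ^ (u ^ 2) \<le> \<rho> ^ (t j)" using \<rho> t(2) by (intro power_increasing) auto
      also have "\<dots> < \<bar>real_of_int (W (t j + \<kappa> (t j)))\<bar>" using \<kappa>(2)[OF t(1)] .
      also have "\<dots> = real (w m)" by (simp add: w_def j h_def)
      finally show ?thesis .
    qed
    have pos: "w m > 0" if "m \<in> S" for m
    proof -
      have "0 < \<rho> ^ (u ^ 2)" using \<rho> by simp
      with big[OF that] have "0 < real (w m)" by linarith
      then show ?thesis by simp
    qed
    define L where "L = Lcm (w ` S)"
    define E where "E = (\<Sum>x\<in>S. \<Sum>y\<in>S - {x}. gcd x y)"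
    have "L \<noteq> 0" using finS by (auto simp: L_def Lcm_0_iff dest: pos)
    have L: "L \<le> 16 * u ^ 4 * (a * b) ^ (16 * u ^ 3)"
      unfolding L_def
    proof (rule Lcm_le_exp_cube[OF ab u(1) finS _ dvd])
      fix m assume "m \<in> S"
      with S_sub have "P \<le> m" "m < P + H" by auto
      then show "1 \<le> m \<and> m \<le> 2 * u ^ 2" using P1 u(3) by (simp add: P_def H_def)
    qed
    have gcds: "(\<Prod>x\<in>S. \<Prod>y\<in>S - {x}. gcd (w x) (w y)) \<le> a ^ E"
      unfolding E_def power_sum
      using m_ge by (intro prod_mono conjI gcd_le_power_gcd[OF ab(1)] dvd) force+
    have "(\<Prod>x\<in>S. w x) \<le> L * (\<Prod>x\<in>S. \<Prod>y\<in>S - {x}. gcd (w x) (w y))"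
      using prod_dvd_Lcm_mult_gcds[OF finS, of w, folded L_def] \<open>L \<noteq> 0\<close>
      by (intro dvd_imp_le) (auto simp: finS intro!: prod_pos dest: pos)
    also have "\<dots> \<le> 16 * u ^ 4 * (a * b) ^ (16 * u ^ 3) * a ^ E"
      using L gcds by (intro mult_mono) auto
    finally have upper: "real (\<Prod>x\<in>S. w x) \<le> 16 * real u ^ 4 * real (a * b) ^ (16 * u ^ 3) * real a ^ E"
      by (simp only: of_nat_le_iff[symmetric, where 'a = real] of_nat_mult of_nat_power of_nat_numeral)
    have "(\<rho> ^ (u ^ 2)) ^ (c * u) = (\<Prod>x\<in>S. \<rho> ^ (u ^ 2))"
      using inj by (simp add: S_def card_image inj_on_subset[OF inj])
    also have "\<dots> \<le> (\<Prod>x\<in>S. real (w x))"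
      using big \<rho> by (intro prod_mono) (auto intro: less_imp_le)
    finally have "\<rho> ^ (c * u ^ 3) \<le> 16 * real u ^ 4 * real (a * b) ^ (16 * u ^ 3) * real a ^ E"
      using upper by (simp add: power2_eq_square power3_eq_cube mult_ac flip: power_mult)
    then have "ln (\<rho> ^ (c * u ^ 3)) \<le> ln (16 * real u ^ 4 * real (a * b) ^ (16 * u ^ 3) * real a ^ E)"
      using \<rho> by (intro ln_mono) auto
    also have "\<dots> = ln 16 + 4 * ln (real u) + 16 * real u ^ 3 * B + real E * A"
      using u(1) ab by (simp add: ln_mult ln_realpow A_def B_def)
    finally have 1: "real c * real u ^ 3 * ln \<rho> \<le> ln 16 + 4 * ln (real u) + 16 * real u ^ 3 * B + real E * A"
      using \<rho> by (simp add: ln_realpow)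
    have "real E * A \<le> 9 * real H ^ 2 * (1 + ln (real H)) * A"
    proof -
      have "real E \<le> 9 * real H ^ 2 * harm H"
        unfolding E_def by (rule sum_gcd_le[OF S_sub P1])
      also have "\<dots> \<le> 9 * real H ^ 2 * (1 + ln (real H))"
        using R u(1) by (intro mult_left_mono harm_le_1_plus_ln) (auto simp: H_def)
      finally show ?thesis using A by simp
    qed
    moreover have "17 * B * real u ^ 3 \<le> real c * ln \<rho> * real u ^ 3"
      using c(2) by (intro mult_right_mono) auto
    ultimately show ?thesis using 1 by (simp add: H_def algebra_simps)
  qed
  have "\<forall>\<^sub>F u in at_top. real u ^ 3 * B > ln 16 + 4 * ln (real u) + 9 * (real R * real u) ^ 2 * (1 + ln (real R * real u)) * A"
  proof -
    define R' where "R' = real R"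
    have "R' > 0" using R by (simp add: R'_def)
    then have "\<forall>\<^sub>F u in at_top. real u ^ 3 * B > ln 16 + 4 * ln (real u) + 9 * (R' * real u) ^ 2 * (1 + ln (R' * real u)) * A"
      using A B by real_asymp
    then show ?thesis by (simp add: R'_def)
  qed
  moreover have "\<forall>\<^sub>F u in at_top. u \<ge> (1 :: nat)" by (rule eventually_ge_at_top)
  moreover have "\<forall>\<^sub>F u in at_top. u ^ 2 \<ge> n0"
    by (rule eventually_mono[OF eventually_ge_at_top[of n0]]) (auto simp: power2_eq_square intro: order.trans[OF _ le_square])
  moreover have "\<forall>\<^sub>F u in at_top. R * u + N \<le> u ^ 2"
  proof (rule eventually_mono[OF eventually_ge_at_top[of "R + N"]])
    fix u assume u: "R + N \<le> u"
    then have "u \<ge> 1" using R by simp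
    then have "R * u + N \<le> R * u + N * u" by simp
    also have "\<dots> = (R + N) * u" by (simp add: algebra_simps)
    also have "\<dots> \<le> u * u" using u by (intro mult_right_mono) auto
    finally show "R * u + N \<le> u ^ 2" by (simp add: power2_eq_square)
  qed
  ultimately have "\<forall>\<^sub>F u in at_top. (ln 16 + 4 * ln (real u) +
      9 * (real R * real u) ^ 2 * (1 + ln (real R * real u)) * A < real u ^ 3 * B) \<and>
      u \<ge> 1 \<and> u ^ 2 \<ge> n0 \<and> R * u + N \<le> u ^ 2"
    by (intro eventually_conj)
  then obtain u :: nat where "ln 16 + 4 * ln (real u) +
      9 * (real R * real u) ^ 2 * (1 + ln (real R * real u)) * A < real u ^ 3 * B"
    "u \<ge> 1" "u ^ 2 \<ge> n0" "R * u + N \<le> u ^ 2"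
    by (auto dest!: eventually_happens)
  with key[of u] show False by linarith
qed

section \<open>Polynomials in the shift operator\<close>

text \<open>
  The action \<open>p(E) V\<close> of a polynomial \<open>p\<close> in the shift operator \<open>E\<close> on a sequence \<open>V\<close>. It makes sequences a module over
  the polynomial ring (\<open>shift_op_mult\<close>), and a linear recurrence says that
  \<open>V\<close> is annihilated by the characteristic polynomial.
\<close>
definition shift_op :: "'a::comm_ring_1 poly \<Rightarrow> (nat \<Rightarrow> 'a) \<Rightarrow> nat \<Rightarrow> 'a" where
  "shift_op p V n = (\<Sum>i\<le>degree p. coeff p i * V (n + i))"

lemma shift_op_eq_sum: "degree p \<le> d \<Longrightarrow> shift_op p V n = (\<Sum>i\<le>d. coeff p i * V (n + i))"
  unfolding shift_op_def by (rule sum.mono_neutral_left) (auto simp: coeff_eq_0)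

lemma shift_op_0 [simp]: "shift_op 0 V n = 0"
  by (simp add: shift_op_def)

lemma shift_op_1 [simp]: "shift_op 1 V = V"
  by (auto simp: shift_op_def)

lemma shift_op_add: "shift_op (p + q) V n = shift_op p V n + shift_op q V n"
proof -
  define d where "d = max (degree p) (degree q)"
  have "degree (p + q) \<le> d" "degree p \<le> d" "degree q \<le> d"
    by (auto simp: d_def degree_add_le_max)
  then show ?thesis by (simp add: shift_op_eq_sum[of _ d] sum.distrib algebra_simps)
qed

lemma shift_op_smult: "shift_op (smult c p) V n = c * shift_op p V n"
  using degree_smult_le[of c p] by (simp add: shift_op_eq_sum[of _ "degree p"] sum_distrib_left mult.assoc)

lemma shift_op_minus: "shift_op (p - q) V n = shift_op p V n - shift_op q V n"
  using shift_op_add[of "p - q" q V n] by simp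

lemma shift_op_pCons: "shift_op (pCons c p) V n = c * V n + shift_op p V (Suc n)"
proof -
  have "shift_op (pCons c p) V n = (\<Sum>i\<le>Suc (degree p). coeff (pCons c p) i * V (n + i))"
    by (rule shift_op_eq_sum) (simp add: degree_pCons_le)
  also have "\<dots> = c * V n + shift_op p V (Suc n)"
    by (simp only: sum.atMost_Suc_shift) (simp add: shift_op_def)
  finally show ?thesis .
qed

lemma shift_op_sum: "shift_op (\<Sum>i\<in>A. p i) V n = (\<Sum>i\<in>A. shift_op (p i) V n)"
  by (induction A rule: infinite_finite_induct) (simp_all add: shift_op_add)

lemma shift_op_monom: "shift_op (monom c k) V n = c * V (n + k)"
  by (induction k arbitrary: n) (simp_all add: monom_0 monom_Suc shift_op_pCons)

lemma shift_op_mult: "shift_op (p * q) V n = shift_op p (shift_op q V) n"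
proof (induction p arbitrary: n)
  case (pCons c p)
  show ?case
    by (simp add: shift_op_add shift_op_smult shift_op_pCons pCons.IH)
qed simp

lemma shift_op_eventually_0_dvd:
  assumes "q dvd p" "\<forall>n\<ge>n0. shift_op q V n = 0"
  shows "\<forall>n\<ge>n0. shift_op p V n = 0"
proof -
  obtain r where r: "p = r * q" using assms(1) by (metis dvd_def mult.commute)
  show ?thesis
    using assms(2) unfolding r shift_op_mult shift_op_def[of r] by simp
qed

lemma shift_op_of_rat:
  "shift_op (map_poly of_rat p) (\<lambda>n. of_rat (V n)) n = (of_rat (shift_op p V n) :: 'a::field_char_0)"
  by (simp add: shift_op_def of_rat_sum of_rat_mult)

lemma shift_op_of_int:
  "shift_op (map_poly of_int p) (\<lambda>n. of_int (V n)) n = (of_int (shift_op p V n) :: 'a::{comm_ring_1,ring_char_0})"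
  by (simp add: shift_op_def)

text \<open>
  Substituting \<open>E ^ M\<close> for \<open>E\<close> restricts the operator to a residue class modulo \<open>M\<close>.
\<close>
lemma shift_op_pcompose_monom:
  "shift_op (pcompose p (monom 1 M)) V (n + M * t) = shift_op p (\<lambda>t. V (n + M * t)) t"
proof (induction p arbitrary: t)
  case (pCons c p)
  have "shift_op (pcompose (pCons c p) (monom 1 M)) V (n + M * t)
      = c * V (n + M * t) + shift_op (pcompose p (monom 1 M)) V (n + M * Suc t)"
    by (simp add: pcompose_pCons shift_op_add shift_op_pCons shift_op_mult shift_op_monom algebra_simps)
  then show ?case by (simp only: shift_op_pCons pCons.IH)
qed simp

section \<open>Recurrences with subexponential windows\<close>

text \<open>
  Along infinitely many windows of any given length, the sequence is smaller than any given exponential. Smallness at single indices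
  would not be inherited by \<open>shift_op p V\<close>, which is why whole windows are required; smallness at
  all indices is more than the determinant method yields.
\<close>
definition subexponential_windows :: "(nat \<Rightarrow> complex) \<Rightarrow> bool" where
  "subexponential_windows V \<longleftrightarrow>
    (\<forall>\<rho>>1. \<forall>r. \<exists>C. \<forall>n0. \<exists>n\<ge>n0. \<forall>k<r. cmod (V (n + k)) \<le> C * \<rho> ^ n)"

lemma subexponential_windows_shift_op:
  assumes "subexponential_windows V"
  shows "subexponential_windows (shift_op p V)"
  unfolding subexponential_windows_def
proof (intro allI impI)
  fix \<rho> :: real and r :: nat assume "\<rho> > 1"
  with assms obtain C where C: "\<And>n0. \<exists>n\<ge>n0. \<forall>k<r + Suc (degree p). cmod (V (n + k)) \<le> C * \<rho> ^ n"
    unfolding subexponential_windows_def by meson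
  define B where "B = (\<Sum>i\<le>degree p. cmod (coeff p i) * C)"
  have "\<exists>n\<ge>n0. \<forall>k<r. cmod (shift_op p V (n + k)) \<le> B * \<rho> ^ n" for n0
  proof -
    obtain n where n: "n \<ge> n0" "\<forall>k<r + Suc (degree p). cmod (V (n + k)) \<le> C * \<rho> ^ n"
      using C by blast
    have "cmod (shift_op p V (n + k)) \<le> B * \<rho> ^ n" if "k < r" for k
    proof -
      have "cmod (shift_op p V (n + k)) \<le> (\<Sum>i\<le>degree p. cmod (coeff p i) * cmod (V (n + (k + i))))"
        unfolding shift_op_def by (rule order.trans[OF norm_sum]) (simp add: norm_mult add.assoc)
      also have "\<dots> \<le> (\<Sum>i\<le>degree p. cmod (coeff p i) * (C * \<rho> ^ n))"
        using that by (intro sum_mono mult_left_mono n(2)[rule_format]) auto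
      also have "\<dots> = B * \<rho> ^ n" by (simp add: B_def sum_distrib_right mult.assoc)
      finally show ?thesis .
    qed
    then show ?thesis using n(1) by blast
  qed
  then show "\<exists>C. \<forall>n0. \<exists>n\<ge>n0. \<forall>k<r. cmod (shift_op p V (n + k)) \<le> C * \<rho> ^ n" by blast
qed

text \<open>
  If \<open>cmod \<alpha> > 1\<close> then \<open>Y\<close> grows exactly like \<open>cmod \<alpha> ^ n\<close>, which infinitely many values below
  \<open>C * sqrt (cmod \<alpha>) ^ n\<close> contradict, unless \<open>Y\<close> vanishes.
\<close>
lemma subexponential_geometric_bounded:
  assumes sub: "subexponential_windows Y" and geo: "\<And>n. n \<ge> n0 \<Longrightarrow> Y (Suc n) = \<alpha> * Y n" and "n \<ge> n0"
  shows "cmod (Y n) \<le> cmod (Y n0)"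
proof -
  have Y: "Y (n0 + j) = \<alpha> ^ j * Y n0" for j
    by (induction j) (simp_all add: geo)
  obtain j where j: "n = n0 + j" using \<open>n \<ge> n0\<close> le_Suc_ex by blast
  show ?thesis
  proof (cases "cmod \<alpha> \<le> 1 \<or> Y n0 = 0")
    case True
    then show ?thesis
      unfolding j Y norm_mult norm_power
      by (cases "Y n0 = 0") (auto intro!: mult_left_le_one_le power_le_one)
  next
    case False
    define \<rho> where "\<rho> = sqrt (cmod \<alpha>)"
    have \<rho>: "\<rho> > 1" "cmod \<alpha> = \<rho> ^ 2" using False by (auto simp: \<rho>_def)
    obtain C where C: "\<And>m. \<exists>n\<ge>m. cmod (Y n) \<le> C * \<rho> ^ n"
      using sub \<rho>(1) unfolding subexponential_windows_def
      by (metis add_0_right less_numeral_extra(1))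
    define D where "D = C * \<rho> ^ (2 * n0) / cmod (Y n0)"
    obtain m where m: "D < \<rho> ^ m" using real_arch_pow[OF \<rho>(1)] by blast
    obtain n where n: "n \<ge> m + n0" "cmod (Y n) \<le> C * \<rho> ^ n" using C by blast
    obtain i where i: "n = n0 + i" using n(1) le_Suc_ex by (metis add_leD2)
    have "\<rho> ^ n * \<rho> ^ n * cmod (Y n0) = cmod (Y n) * \<rho> ^ (2 * n0)"
      unfolding i Y norm_mult norm_power \<rho>(2)
      by (simp add: power_add power_mult power2_eq_square power_mult_distrib mult_ac)
    also have "\<dots> \<le> C * \<rho> ^ n * \<rho> ^ (2 * n0)"
      using n(2) \<rho>(1) by (intro mult_right_mono) auto
    finally have "\<rho> ^ n * (\<rho> ^ n * cmod (Y n0)) \<le> \<rho> ^ n * (C * \<rho> ^ (2 * n0))"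
      by (simp add: mult_ac)
    then have "\<rho> ^ n * cmod (Y n0) \<le> C * \<rho> ^ (2 * n0)"
      using \<rho>(1) by (simp only: mult_le_cancel_left_pos zero_less_power)
    then have "\<rho> ^ n \<le> D" using False by (simp add: D_def field_simps)
    moreover have "\<rho> ^ m \<le> \<rho> ^ n" using \<rho>(1) n(1) by (intro power_increasing) auto
    ultimately show ?thesis using m by linarith
  qed
qed

lemma lagrange_partition_of_unity:
  fixes A :: "'a::field set"
  assumes "finite A" "A \<noteq> {}"
  defines "\<psi> \<equiv> \<lambda>z. \<Prod>y\<in>A - {z}. [:- y, 1:]"
  shows "(\<Sum>z\<in>A. smult (1 / poly (\<psi> z) z) (\<psi> z)) = 1"
proof (rule poly_eqI_degree[where A = A])
  fix y assume y: "y \<in> A"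
  have "poly (\<Sum>z\<in>A. smult (1 / poly (\<psi> z) z) (\<psi> z)) y = (\<Sum>z\<in>A. if z = y then 1 else 0)"
    unfolding poly_sum
  proof (intro sum.cong refl)
    fix z assume "z \<in> A"
    show "poly (smult (1 / poly (\<psi> z) z) (\<psi> z)) y = (if z = y then 1 else 0)"
      using assms(1) y by (auto simp: \<psi>_def poly_prod)
  qed
  then show "poly (\<Sum>z\<in>A. smult (1 / poly (\<psi> z) z) (\<psi> z)) y = poly 1 y"
    using assms(1) y by simp
next
  have "degree (smult (1 / poly (\<psi> z) z) (\<psi> z)) < card A" if "z \<in> A" for z
  proof -
    have "degree (\<psi> z) = card A - 1"
      using that assms(1) by (simp add: \<psi>_def degree_prod_eq_sum_degree)
    moreover have "card A > 0" using assms by (simp add: card_gt_0_iff)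
    ultimately show ?thesis using degree_smult_le[of "1 / poly (\<psi> z) z" "\<psi> z"] by linarith
  qed
  then show "degree (\<Sum>z\<in>A. smult (1 / poly (\<psi> z) z) (\<psi> z)) < card A"
    using assms by (intro degree_sum_less) (auto simp: card_gt_0_iff)
  show "degree (1 :: 'a poly) < card A" using assms by (simp add: card_gt_0_iff)
qed

text \<open>
  Applying \<open>\<psi> z\<close>, the product over all roots other than \<open>z\<close>, projects \<open>V\<close> to its geometric component
  of ratio \<open>z\<close>. Each component is bounded by the previous lemma, and by Lagrange interpolation \<open>V\<close> is a linear
  combination of its components.
\<close>
lemma subexponential_simple_roots_bounded:
  assumes A: "finite A" and sub: "subexponential_windows V"
    and rec: "\<And>n. n \<ge> n0 \<Longrightarrow> shift_op (\<Prod>z\<in>A. [:- z, 1:]) V n = 0"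
  shows "\<exists>B. \<forall>n. cmod (V n) \<le> B"
proof -
  define \<psi> where "\<psi> z = (\<Prod>y\<in>A - {z}. [:- y, 1:])" for z
  define B where "B = (\<Sum>z\<in>A. cmod (1 / poly (\<psi> z) z) * cmod (shift_op (\<psi> z) V n0))"
  have tail: "cmod (V n) \<le> B" if n: "n \<ge> n0" for n
  proof (cases "A = {}")
    case True
    then show ?thesis using rec[OF n] by (simp add: B_def)
  next
    case False
    have Y: "cmod (shift_op (\<psi> z) V n) \<le> cmod (shift_op (\<psi> z) V n0)" if z: "z \<in> A" for z
    proof (rule subexponential_geometric_bounded[OF subexponential_windows_shift_op[OF sub] _ n])
      fix m assume m: "m \<ge> n0"
      have "(\<Prod>z\<in>A. [:- z, 1:]) = [:- z, 1:] * \<psi> z"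
        using z A by (simp add: \<psi>_def prod.remove)
      with rec[OF m] show "shift_op (\<psi> z) V (Suc m) = z * shift_op (\<psi> z) V m"
        by (simp add: shift_op_mult shift_op_pCons del: mult_pCons_left)
    qed
    have "V n = shift_op (\<Sum>z\<in>A. smult (1 / poly (\<psi> z) z) (\<psi> z)) V n"
      using lagrange_partition_of_unity[OF A False] by (simp add: \<psi>_def)
    also have "\<dots> = (\<Sum>z\<in>A. 1 / poly (\<psi> z) z * shift_op (\<psi> z) V n)"
      by (simp add: shift_op_sum shift_op_smult)
    also have "cmod \<dots> \<le> B"
      unfolding B_def
      by (rule order.trans[OF norm_sum], rule sum_mono) (simp add: norm_mult norm_divide divide_right_mono Y)
    finally show ?thesis .
  qed
  define B' where "B' = B + (\<Sum>i<n0. cmod (V i))"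
  have "cmod (V n) \<le> B'" for n
  proof (cases "n \<ge> n0")
    case True
    have "0 \<le> (\<Sum>i<n0. cmod (V i))" by (intro sum_nonneg) auto
    with tail[OF True] show ?thesis unfolding B'_def by linarith
  next
    case False
    have "cmod (V n) \<le> (\<Sum>i<n0. cmod (V i))" using False by (intro member_le_sum) auto
    moreover have "0 \<le> B" by (auto simp: B_def intro!: sum_nonneg)
    ultimately show ?thesis unfolding B'_def by linarith
  qed
  then show ?thesis by blast
qed

text \<open>
  Two windows of length \<open>degree p\<close> coincide by the pigeonhole principle, and the recurrence determines
  everything that follows a window.
\<close>
lemma finite_range_recurrence_periodic:
  fixes V :: "nat \<Rightarrow> 'a::field"
  assumes fin: "finite (range V)" and p: "p \<noteq> 0" and rec: "\<And>n. n \<ge> n0 \<Longrightarrow> shift_op p V n = 0"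
  shows "\<exists>M\<ge>1. \<exists>n1. \<forall>n\<ge>n1. V (n + M) = V n"
proof -
  define d where "d = degree p"
  define state where "state n = map V [n..<n + d]" for n
  have "state ` {n0..} \<subseteq> {xs. set xs \<subseteq> range V \<and> length xs = d}"
    by (auto simp: state_def)
  then have "finite (state ` {n0..})"
    using finite_lists_length_eq[OF fin] finite_subset by blast
  then have "\<not> inj_on state {n0..}"
    using finite_imageD infinite_Ici by blast
  then obtain i j where ij: "n0 \<le> i" "i < j" "state i = state j"
    unfolding inj_on_def by (metis atLeast_iff linorder_neqE_nat)
  have next_term: "lead_coeff p * V (n + d) = - (\<Sum>l<d. coeff p l * V (n + l))" if "n \<ge> n0" for n
  proof -
    have "(\<Sum>l\<le>d. coeff p l * V (n + l)) = (\<Sum>l<d. coeff p l * V (n + l)) + lead_coeff p * V (n + d)"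
      by (simp add: d_def flip: lessThan_Suc_atMost)
    then show ?thesis
      using rec[OF that] unfolding shift_op_def d_def[symmetric] by (simp add: eq_neg_iff_add_eq_0 add.commute)
  qed
  have "V (i + k) = V (j + k)" for k
  proof (induction k rule: less_induct)
    case (less k)
    show ?case
    proof (cases "k < d")
      case True
      have "state i ! k = state j ! k" using ij(3) by simp
      then show ?thesis using True by (simp add: state_def)
    next
      case False
      then obtain l where l: "k = l + d" by (metis add.commute le_Suc_ex not_less)
      have "(\<Sum>e<d. coeff p e * V (i + l + e)) = (\<Sum>e<d. coeff p e * V (j + l + e))"
        by (intro sum.cong refl) (simp add: less l add.assoc)
      then have "lead_coeff p * V (i + l + d) = lead_coeff p * V (j + l + d)"
        using next_term[of "i + l"] next_term[of "j + l"] ij by simp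
      then show ?thesis using p by (simp add: l add.assoc)
    qed
  qed
  note shifted = this
  have "V (n + (j - i)) = V n" if "n \<ge> i" for n
  proof -
    have "j + (n - i) = n + (j - i)" "i + (n - i) = n" using that ij(2) by simp_all
    with shifted[of "n - i"] show ?thesis by metis
  qed
  then show ?thesis using ij(2) by (intro exI[of _ "j - i"] exI[of _ i] conjI) auto
qed

text \<open>
  An irreducible polynomial over the rationals is coprime to its derivative, and a Bezout relation between the two survives the passage
  to the complex numbers.
\<close>
lemma rsquarefree_of_rat_prime:
  fixes \<mu> :: "rat poly"
  assumes "prime \<mu>"
  shows "rsquarefree (map_poly of_rat \<mu> :: complex poly)"
proof -
  interpret map_poly_comm_ring_hom "of_rat :: rat \<Rightarrow> complex" ..
  have \<mu>: "\<mu> \<noteq> 0" using assms by auto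
  moreover have "\<not> is_unit \<mu>" using assms not_prime_unit by blast
  ultimately have deg: "degree \<mu> > 0" using is_unit_iff_degree[OF \<mu>(1)] by (metis gr0I)
  then have "pderiv \<mu> \<noteq> 0" by (simp add: pderiv_eq_0_iff)
  moreover have "degree (pderiv \<mu>) < degree \<mu>" using deg by (simp add: degree_pderiv)
  ultimately have "\<not> \<mu> dvd pderiv \<mu>" using dvd_imp_degree_le leD by blast
  with assms have "coprime \<mu> (pderiv \<mu>)" by (rule prime_imp_coprime)
  then have "gcd \<mu> (pderiv \<mu>) = 1" by simp
  then obtain r s where "r * \<mu> + s * pderiv \<mu> = 1"
    using bezout_coefficients_fst_snd[of \<mu> "pderiv \<mu>"] by metis
  then have "map_poly of_rat (r * \<mu> + s * pderiv \<mu>) = (1 :: complex poly)" by simp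
  then have bez: "map_poly of_rat r * map_poly of_rat \<mu> + map_poly of_rat s * pderiv (map_poly of_rat \<mu>) = (1 :: complex poly)"
    by (simp add: hom_distribs of_rat_hom.map_poly_pderiv)
  show ?thesis
    unfolding rsquarefree_roots
  proof (intro allI notI)
    fix z assume "poly (map_poly of_rat \<mu>) z = 0 \<and> poly (pderiv (map_poly of_rat \<mu>)) z = (0 :: complex)"
    with arg_cong[OF bez, of "\<lambda>p. poly p z"] show False by simp
  qed
qed

lemma common_denominator:
  fixes q :: "rat poly"
  shows "\<exists>D>0. \<forall>i. of_nat D * coeff q i \<in> \<int>"
proof (induction q)
  case 0
  show ?case by (intro exI[of _ 1]) auto
next
  case (pCons c q)
  then obtain D where D: "D > 0" "\<And>i. of_nat D * coeff q i \<in> \<int>" by blast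
  obtain x y where c: "c = of_int x / of_int y" "y > 0" by (metis quotient_of_div quotient_of_denom_pos surj_pair)
  show ?case
  proof (intro exI[of _ "D * nat y"] conjI allI)
    show "0 < D * nat y" using D c by simp
    fix i
    show "of_nat (D * nat y) * coeff (pCons c q) i \<in> \<int>"
    proof (cases i)
      case 0
      then have "of_nat (D * nat y) * coeff (pCons c q) i = of_int (int D * x)"
        using c by simp
      then show ?thesis by (metis Ints_of_int)
    next
      case (Suc j)
      then have "of_nat (D * nat y) * coeff (pCons c q) i = of_nat (nat y) * (of_nat D * coeff q j)"
        by simp
      then show ?thesis using D(2) by (metis Ints_mult Ints_of_nat)
    qed
  qed
qed

lemma finite_bounded_fractions:
  assumes "D > 0"
  shows "finite {x :: rat. of_nat D * x \<in> \<int> \<and> \<bar>x\<bar> \<le> B}"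
proof (rule finite_subset)
  show "{x :: rat. of_nat D * x \<in> \<int> \<and> \<bar>x\<bar> \<le> B} \<subseteq>
    (\<lambda>k. of_int k / of_nat D) ` {- \<lceil>of_nat D * B\<rceil>..\<lceil>of_nat D * B\<rceil>}"
  proof
    fix x :: rat assume "x \<in> {x. of_nat D * x \<in> \<int> \<and> \<bar>x\<bar> \<le> B}"
    then obtain k where k: "of_nat D * x = of_int k" and x: "\<bar>x\<bar> \<le> B" by (auto elim: Ints_cases)
    have "\<bar>of_int k :: rat\<bar> \<le> of_nat D * B"
      using x by (simp add: k[symmetric] abs_mult mult_left_mono)
    also have "\<dots> \<le> of_int \<lceil>of_nat D * B\<rceil>" by simp
    finally have "\<bar>k\<bar> \<le> \<lceil>of_nat D * B\<rceil>" by (simp only: of_int_abs[symmetric] of_int_le_iff)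
    then show "x \<in> (\<lambda>k. of_int k / of_nat D) ` {- \<lceil>of_nat D * B\<rceil>..\<lceil>of_nat D * B\<rceil>}"
      using k assms by (intro image_eqI[of _ _ k]) (auto simp: field_simps)
  qed
qed simp

lemma X_power_minus_1_dvd:
  "(monom 1 M - 1 :: 'a::comm_ring_1 poly) dvd monom 1 (M * L) - 1"
proof -
  have "monom 1 (M * L) = (monom 1 M :: 'a poly) ^ L" by (simp add: monom_power)
  then show ?thesis by (metis dvd_triv_left power_diff_1_eq)
qed

text \<open>
  By induction on the degree of the annihilating polynomial. Let \<open>\<mu>\<close> be an irreducible factor and \<open>p = \<mu> * \<kappa>\<close>.
  The sequence \<open>V = (\<kappa> * q)(E) W\<close> is annihilated by \<open>\<mu>\<close>, which has simple complex roots; so \<open>V\<close> is bounded. Since its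
  values have a common denominator, it has finite range and some \<open>E ^ M - 1\<close> annihilates it eventually. Then \<open>\<kappa>\<close>, of smaller
  degree, annihilates \<open>((E ^ M - 1) * q) W\<close>. The polynomial \<open>q\<close> is there to
  accumulate these factors; in the end it is \<open>1\<close>. This replaces Kronecker's theorem on algebraic integers
  whose conjugates lie in the unit disc.
\<close>
theorem annihilated_by_power_of_X_power_minus_1:
  fixes W :: "nat \<Rightarrow> int" and p q :: "rat poly"
  assumes sub: "subexponential_windows (\<lambda>n. of_int (W n))"
    and "p \<noteq> 0" and "\<And>n. n \<ge> n0 \<Longrightarrow> shift_op (p * q) (\<lambda>n. of_int (W n)) n = 0"
  shows "\<exists>M\<ge>1. \<exists>k n1. \<forall>n\<ge>n1. shift_op ((monom 1 M - 1) ^ k * q) (\<lambda>n. of_int (W n)) n = 0"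
  using assms(2,3)
proof (induction "degree p" arbitrary: p q n0 rule: less_induct)
  case less
  let ?W = "\<lambda>n. rat_of_int (W n)"
  show ?case
  proof (cases "degree p = 0")
    case True
    then obtain c where c: "p = [:c:]" "c \<noteq> 0" using less.prems(1) by (auto elim: degree_eq_zeroE)
    then have "\<forall>n\<ge>n0. shift_op ((monom 1 1 - 1) ^ 0 * q) ?W n = 0"
      using less.prems(2) by (simp add: shift_op_smult)
    then show ?thesis by (meson order_refl)
  next
    case False
    then have "\<not> is_unit p" using less.prems(1) by (simp add: is_unit_iff_degree)
    then obtain \<mu> where \<mu>: "prime \<mu>" "\<mu> dvd p" using prime_divisor_exists[OF less.prems(1)] by blast
    then obtain \<kappa> where p: "p = \<mu> * \<kappa>" by (auto simp: dvd_def)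
    have nz: "\<mu> \<noteq> 0" "\<kappa> \<noteq> 0" using less.prems(1) p by auto
    have "degree \<mu> > 0" using \<mu>(1) nz by (metis gr0I is_unit_iff_degree not_prime_unit)
    then have deg: "degree \<kappa> < degree p" using nz by (simp add: p degree_mult_eq)
    define V where "V = shift_op (\<kappa> * q) ?W"
    have V_rec: "shift_op \<mu> V n = 0" if "n \<ge> n0" for n
      using less.prems(2)[OF that] by (simp add: V_def p mult.assoc shift_op_mult[of \<mu>])
    define V' where "V' = (\<lambda>n. of_rat (V n) :: complex)"
    have "V' n = shift_op (map_poly of_rat (\<kappa> * q)) (\<lambda>n. of_int (W n)) n" for n
      using shift_op_of_rat[of "\<kappa> * q" ?W n, where 'a = complex] by (simp add: V'_def V_def)
    then have "V' = shift_op (map_poly of_rat (\<kappa> * q)) (\<lambda>n. of_int (W n))" by (rule ext)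
    then have "subexponential_windows V'"
      using subexponential_windows_shift_op[OF sub] by simp
    moreover
    define \<mu>' where "\<mu>' = (map_poly of_rat \<mu> :: complex poly)"
    have "\<mu>' \<noteq> 0" using nz by (simp add: \<mu>'_def)
    have \<mu>': "smult (lead_coeff \<mu>') (\<Prod>z | poly \<mu>' z = 0. [:- z, 1:]) = \<mu>'"
      unfolding \<mu>'_def by (rule complex_poly_decompose_rsquarefree[OF rsquarefree_of_rat_prime[OF \<mu>(1)]])
    have "shift_op (\<Prod>z | poly \<mu>' z = 0. [:- z, 1:]) V' n = 0" if "n \<ge> n0" for n
    proof -
      have "shift_op \<mu>' V' n = 0"
        using shift_op_of_rat[of \<mu> V n, where 'a = complex] V_rec[OF that] by (simp add: \<mu>'_def V'_def)
      then show ?thesis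
        using \<open>\<mu>' \<noteq> 0\<close> by (subst (asm) \<mu>'[symmetric]) (simp add: shift_op_smult)
    qed
    ultimately obtain B where B: "\<And>n. cmod (V' n) \<le> B"
      using subexponential_simple_roots_bounded[of "{z. poly \<mu>' z = 0}" V' n0] poly_roots_finite[OF \<open>\<mu>' \<noteq> 0\<close>]
      by blast
    obtain D where D: "D > 0" "\<And>i. of_nat D * coeff (\<kappa> * q) i \<in> \<int>"
      using common_denominator by blast
    have "V n \<in> {x. of_nat D * x \<in> \<int> \<and> \<bar>x\<bar> \<le> of_int \<lceil>B\<rceil>}" for n
    proof (intro CollectI conjI)
      have "of_nat D * V n = (\<Sum>i\<le>degree (\<kappa> * q). (of_nat D * coeff (\<kappa> * q) i) * of_int (W (n + i)))"
        by (simp add: V_def shift_op_def sum_distrib_left mult.assoc)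
      also have "\<dots> \<in> \<int>" by (intro Ints_sum Ints_mult D(2)) auto
      finally show "of_nat D * V n \<in> \<int>" .
      have "V' n = of_real (of_rat (V n))" by (cases "V n") (simp add: V'_def of_rat_rat)
      then have "\<bar>of_rat (V n)\<bar> \<le> B" using B[of n] by simp
      also have "\<dots> \<le> of_int \<lceil>B\<rceil>" by simp
      finally have "of_rat \<bar>V n\<bar> \<le> (of_rat (of_int \<lceil>B\<rceil>) :: real)" by simp
      then show "\<bar>V n\<bar> \<le> of_int \<lceil>B\<rceil>" by (simp only: of_rat_less_eq)
    qed
    then have "finite (range V)"
      by (intro finite_subset[OF _ finite_bounded_fractions[OF D(1), of "of_int \<lceil>B\<rceil>"]]) blast
    then obtain M n1 where M: "M \<ge> 1" "\<And>n. n \<ge> n1 \<Longrightarrow> V (n + M) = V n"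
      using finite_range_recurrence_periodic[OF _ nz(1) V_rec] by blast
    have "shift_op (\<kappa> * ((monom 1 M - 1) * q)) ?W n = 0" if "n \<ge> n1" for n
    proof -
      have "shift_op (\<kappa> * ((monom 1 M - 1) * q)) ?W n = shift_op (monom 1 M - 1) V n"
        by (simp add: V_def mult.left_commute[of \<kappa>] shift_op_mult[of "monom 1 M - 1"])
      also have "\<dots> = 0" using M(2)[OF that] by (simp add: shift_op_minus shift_op_monom)
      finally show ?thesis .
    qed
    from less.hyps[OF deg nz(2) this] obtain L k n2 where L: "L \<ge> 1"
      "\<forall>n\<ge>n2. shift_op ((monom 1 L - 1) ^ k * ((monom 1 M - 1) * q)) ?W n = 0" by blast
    have "(monom 1 L - 1) ^ k * ((monom 1 M - 1) * q) dvd (monom 1 (M * L) - 1) ^ Suc k * q"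
    proof -
      have "(monom 1 L - 1) ^ k * (monom 1 M - 1) dvd (monom 1 (M * L) - 1) ^ k * (monom 1 (M * L) - 1 :: rat poly)"
        using X_power_minus_1_dvd[of L M] X_power_minus_1_dvd[of M L]
        by (intro mult_dvd_mono dvd_power_same) (simp_all add: mult.commute)
      then have "((monom 1 L - 1) ^ k * (monom 1 M - 1)) * q dvd ((monom 1 (M * L) - 1) ^ k * (monom 1 (M * L) - 1)) * q"
        by (rule mult_dvd_mono) simp
      then show ?thesis by (simp only: power_Suc2 mult.assoc)
    qed
    from shift_op_eventually_0_dvd[OF this L(2)] show ?thesis
      using M(1) L(1) by (intro exI[of _ "M * L"] conjI exI[of _ "Suc k"] exI[of _ n2]) auto
  qed
qed

section \<open>Integer-valued polynomials dividing \<open>a ^ (m + M * t) - 1\<close>\<close>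

text \<open>
  Apply \<open>E ^ t = ((E - 1) + 1) ^ t\<close>, expanded by the binomial theorem, at index \<open>0\<close>. In this basis
  the coefficients stay integral, which the congruences below need.
\<close>
lemma newton_expansion:
  fixes f :: "nat \<Rightarrow> int"
  assumes "\<And>t. shift_op ([:- 1, 1:] ^ k) f t = 0"
  shows "f t = (\<Sum>i<k. int (t choose i) * shift_op ([:- 1, 1:] ^ i) f 0)"
proof -
  let ?c = "\<lambda>i. shift_op ([:- 1, 1:] ^ i) f 0"
  have c0: "?c i = 0" if "i \<ge> k" for i
    using shift_op_eventually_0_dvd[of "[:- 1, 1:] ^ k" "[:- 1, 1:] ^ i" 0 f] assms that
    by (auto intro: le_imp_power_dvd)
  have "monom 1 t = ([:- 1, 1:] + 1 :: int poly) ^ t"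
    by (simp add: monom_altdef one_pCons)
  also have "\<dots> = (\<Sum>i\<le>t. smult (int (t choose i)) ([:- 1, 1:] ^ i))"
    by (simp add: binomial_ring of_nat_poly)
  finally have "shift_op (monom 1 t) f 0 = (\<Sum>i\<le>t. int (t choose i) * ?c i)"
    by (simp add: shift_op_sum shift_op_smult)
  also have "\<dots> = (\<Sum>i\<in>{..t} \<union> {..<k}. int (t choose i) * ?c i)"
    by (rule sum.mono_neutral_left) auto
  also have "\<dots> = (\<Sum>i<k. int (t choose i) * ?c i)"
    by (rule sum.mono_neutral_right) (auto simp: c0)
  finally show ?thesis by (simp add: shift_op_monom)
qed

text \<open>
  From \<open>l * (h choose l) = h * ((h - 1) choose (l - 1))\<close> with \<open>h = q * fact k * j\<close>: the factor \<open>l\<close> cancels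
  against \<open>fact k\<close>.
\<close>
lemma dvd_choose_multiple_of_fact:
  assumes "1 \<le> l" "l \<le> k"
  shows "q dvd (q * fact k * j) choose l"
proof -
  obtain s where s: "fact k = l * s" using assms dvd_fact[of l k] by (auto simp: dvd_def)
  have "l * ((q * fact k * j) choose l) = (q * fact k * j) * ((q * fact k * j - 1) choose (l - 1))"
    using assms times_binomial_minus1_eq[of l "q * fact k * j"] by simp
  also have "\<dots> = l * (q * (s * j * ((q * fact k * j - 1) choose (l - 1))))"
    by (simp add: s mult_ac)
  finally show ?thesis using assms by simp
qed

lemma choose_add_multiple_of_fact_cong:
  assumes "i \<le> k"
  shows "[(q * fact k * j + t) choose i = t choose i] (mod q)"
proof -
  let ?h = "q * fact k * j"
  have "(?h + t) choose i = (\<Sum>l\<le>i. (?h choose l) * (t choose (i - l)))"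
    by (rule vandermonde[symmetric])
  also have "[\<dots> = (\<Sum>l\<le>i. if l = 0 then t choose i else 0)] (mod q)"
  proof (intro cong_sum)
    fix l assume l: "l \<in> {..i}"
    show "[(?h choose l) * (t choose (i - l)) = (if l = 0 then t choose i else 0)] (mod q)"
      using dvd_choose_multiple_of_fact[of l k q j] l assms by (auto simp: cong_0_iff)
  qed
  also have "(\<Sum>l\<le>i. if l = 0 then t choose i else 0) = t choose i" by simp
  finally show ?thesis .
qed

text \<open>
  Modulo \<open>q\<close> the function \<open>f\<close> has period \<open>q * fact k\<close>. If a prime \<open>p\<close> divides \<open>f t\<close>, it also divides
  \<open>f (t + p * fact k)\<close>, so \<open>a ^ (M * p * fact k) \<equiv> 1\<close> modulo \<open>p\<close>, and by Fermat's theorem \<open>p\<close> divides the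
  number \<open>B = a ^ (M * fact k) - 1\<close>, which depends on neither \<open>p\<close> nor \<open>t\<close>. On the other hand, for \<open>t\<close> in a suitable progression,
  periodicity modulo \<open>f 0 * B\<close> gives \<open>f t = f 0 * (1 + B * s)\<close>, and no prime divisor of
  \<open>1 + B * s\<close> divides \<open>B\<close>. Hence \<open>f t\<close> is \<open>f 0\<close> or \<open>- f 0\<close> infinitely often, which only a constant
  polynomial can achieve.
\<close>
lemma integer_valued_polynomial_dividing_powers_constant:
  fixes f c :: "nat \<Rightarrow> int"
  assumes f: "\<And>t. f t = (\<Sum>i<k. int (t choose i) * c i)"
    and a: "a \<ge> 2" and M: "M \<ge> 1" and nz: "\<And>t. f t \<noteq> 0"
    and dvd: "\<And>t. f t dvd int a ^ (m + M * t) - 1"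
  shows "f t = f 0"
proof -
  have period: "[f (q * fact k * j + t) = f t] (mod int q)" for q j t
    unfolding f using choose_add_multiple_of_fact_cong[of _ k q j t]
    by (intro cong_sum cong_mult cong_refl) (simp add: cong_int_iff)
  define B where "B = int a ^ (M * fact k) - 1"
  have prime_dvd_B: "int p dvd B" if p: "prime p" "int p dvd f t" for p t
  proof -
    let ?e = "m + M * t" and ?d = "M * fact k"
    have "[f t = 0] (mod int p)" using p(2) by (simp only: cong_0_iff)
    then have "[f (p * fact k * 1 + t) = 0] (mod int p)"
      by (rule cong_trans[OF period])
    then have "int p dvd f (p * fact k * 1 + t)" by (simp only: cong_0_iff)
    then have "int p dvd int a ^ (m + M * (p * fact k * 1 + t)) - 1"
      by (rule dvd_trans[OF _ dvd])
    then have 1: "[a ^ (?e + p * ?d) = 1] (mod p)"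
      by (simp add: algebra_simps cong_iff_dvd_diff flip: cong_int_iff)
    have "int p dvd int a ^ ?e - 1" using p(2) dvd by (rule dvd_trans)
    then have 2: "[a ^ ?e = 1] (mod p)"
      by (simp add: cong_iff_dvd_diff flip: cong_int_iff)
    have "\<not> p dvd a"
    proof
      assume "p dvd a"
      show False
      proof (cases "?e + p * ?d = 0")
        case True
        then show False using p(1) M by auto
      next
        case False
        then have "p dvd a ^ (?e + p * ?d)"
          by (intro dvd_trans[OF \<open>p dvd a\<close> dvd_power]) simp
        then have "[a ^ (?e + p * ?d) = 0] (mod p)" by (simp only: cong_0_iff)
        with 1 have "[1 = 0] (mod p)" using cong_sym cong_trans by blast
        then show False using p(1) by (simp add: cong_0_iff)
      qed
    qed
    then have fermat: "[a ^ (p - 1) = 1] (mod p)" by (rule fermat_theorem[OF p(1)])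
    have "[(a ^ (p - 1)) ^ ?d * a ^ ?d = 1 ^ ?d * a ^ ?d] (mod p)"
      by (intro cong_mult cong_pow fermat cong_refl)
    also have "(a ^ (p - 1)) ^ ?d * a ^ ?d = a ^ (p * ?d)"
    proof -
      have "p * ?d = (p - 1) * ?d + ?d" using prime_gt_0_nat[OF p(1)] by (simp add: algebra_simps diff_mult_distrib)
      then show ?thesis by (simp only: power_add power_mult)
    qed
    finally have 3: "[a ^ (p * ?d) = a ^ ?d] (mod p)" by simp
    have "[a ^ ?e * a ^ (p * ?d) = 1 * a ^ ?d] (mod p)" by (intro cong_mult 2 3)
    with 1 have "[a ^ ?d = 1] (mod p)" by (metis cong_sym cong_trans mult_1 power_add)
    then have "[int a ^ ?d = 1] (mod int p)" by (metis cong_int_iff of_nat_1 of_nat_power)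
    then show ?thesis by (simp add: B_def cong_iff_dvd_diff)
  qed
  define A where "A = nat \<bar>f 0\<bar>"
  have "M * fact k \<noteq> 0" using M by simp
  then have "int a ^ (M * fact k) > 1" using a by (intro one_less_power) auto
  then have B: "B > 0" by (simp add: B_def)
  define h where "h = A * nat B * fact k"
  have "h > 0" using B nz[of 0] by (simp add: h_def A_def)
  have abs_eq: "\<bar>f (h * j)\<bar> = \<bar>f 0\<bar>" for j
  proof -
    have "[f (A * nat B * fact k * j + 0) = f 0] (mod int (A * nat B))" by (rule period)
    then have "\<bar>f 0\<bar> * B dvd f (h * j) - f 0"
      using B by (simp add: h_def A_def cong_iff_dvd_diff)
    then have "f 0 * B dvd f (h * j) - f 0" by (metis abs_dvd_iff abs_mult abs_mult_self_eq mult_dvd_mono abs_of_pos B dvd_refl dvd_abs_iff)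
    then obtain s where "f (h * j) - f 0 = f 0 * B * s" by (auto simp: dvd_def)
    then have s: "f (h * j) = f 0 * (1 + B * s)" by (simp add: algebra_simps)
    have "\<bar>1 + B * s\<bar> = 1"
    proof (rule ccontr)
      assume "\<bar>1 + B * s\<bar> \<noteq> 1"
      then have "nat \<bar>1 + B * s\<bar> \<noteq> 1" by linarith
      then obtain p where p: "prime p" "p dvd nat \<bar>1 + B * s\<bar>" using prime_factor_nat by blast
      then have p1: "int p dvd 1 + B * s" by (simp add: int_dvd_int_iff[symmetric] del: int_dvd_int_iff)
      then have "int p dvd f (h * j)" by (simp add: s)
      then have "int p dvd B" by (rule prime_dvd_B[OF p(1)])
      with p1 have "int p dvd 1" by (metis dvd_add_left_iff dvd_mult2)
      then show False using p(1) by simp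
    qed
    then show ?thesis by (simp add: s abs_mult)
  qed
  define F :: "real poly" where
    "F = (\<Sum>i<k. smult (of_int (c i) / fact i) (\<Prod>l<i. [:- of_nat l, 1:]))"
  have F: "poly F (of_nat t) = of_int (f t)" for t
  proof -
    have "of_nat (t choose i) = poly (\<Prod>l<i. [:- of_nat l, 1:]) (of_nat t :: real) / fact i" for i
      by (simp add: binomial_gbinomial gbinomial_prod_rev poly_prod atLeast0LessThan)
    then show ?thesis by (simp add: F_def f poly_sum mult.commute)
  qed
  \<comment> \<open>The zeros of \<open>G\<close> are the points where \<open>F\<close> takes one of the values \<open>f 0\<close> and \<open>- f 0\<close>.\<close>
  define G where "G = (F - [:of_int (f 0):]) * (F + [:of_int (f 0):])"
  have "G = 0"
  proof (rule ccontr)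
    assume "G \<noteq> 0"
    have "poly G (of_nat (h * j)) = 0" for j
    proof -
      have "f (h * j) = f 0 \<or> f (h * j) = - f 0" using abs_eq[of j] by (simp add: abs_eq_iff)
      then show ?thesis unfolding G_def poly_mult poly_diff poly_add F by auto
    qed
    then have "range (\<lambda>j. of_nat (h * j)) \<subseteq> {x. poly G x = 0}" by blast
    moreover have "infinite (range (\<lambda>j. of_nat (h * j) :: real))"
      using \<open>h > 0\<close> by (intro range_inj_infinite injI) simp
    ultimately show False using poly_roots_finite[OF \<open>G \<noteq> 0\<close>] finite_subset by blast
  qed
  then have "F = [:of_int (f 0):] \<or> F = - [:of_int (f 0):]"
    by (simp only: G_def mult_eq_0_iff right_minus_eq eq_neg_iff_add_eq_0)
  then have "poly F (of_nat t) = poly F (of_nat 0)" by auto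
  then show ?thesis unfolding F by simp
qed

section \<open>Eventual periodicity\<close>

text \<open>
  A nonzero trailing coefficient makes \<open>u n\<close> a function of the terms that follow it, so periodicity propagates downwards.
\<close>
lemma periodic_from_start:
  assumes rec: "satisfies_rec d c u" and cd: "c d \<noteq> 0" and per: "\<And>n. n \<ge> n0 \<Longrightarrow> u (n + M) = u n"
    and "n \<ge> 1"
  shows "u (n + M) = u n"
proof -
  have d: "d \<ge> 1" and rec': "\<And>n. n \<ge> 1 \<Longrightarrow> u (n + d) = (\<Sum>i=1..d. c i * u (n + d - i))"
    using rec by (auto simp: satisfies_rec_def)
  have split: "c d * u n = u (n + d) - (\<Sum>i=1..<d. c i * u (n + d - i))" if "n \<ge> 1" for n
  proof -
    have "{1..d} = insert d {1..<d}" using d by auto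
    then show ?thesis using rec'[OF that] by simp
  qed
  have "\<forall>n\<ge>1. n + j \<ge> n0 \<longrightarrow> u (n + M) = u n" for j
  proof (induction j)
    case 0
    then show ?case using per by simp
  next
    case (Suc j)
    show ?case
    proof (intro allI impI)
      fix n :: nat assume n: "n \<ge> 1" "n + Suc j \<ge> n0"
      have later: "u (l + M) = u l" if "l > n" for l using Suc n that by auto
      have "c d * u (n + M) = u (n + d + M) - (\<Sum>i=1..<d. c i * u (n + M + d - i))"
        using split[of "n + M"] n by (simp add: ac_simps)
      also have "(\<Sum>i=1..<d. c i * u (n + M + d - i)) = (\<Sum>i=1..<d. c i * u (n + d - i))"
      proof (intro sum.cong refl)
        fix i assume "i \<in> {1..<d}"
        then have "n + M + d - i = (n + d - i) + M" "n + d - i > n" by auto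
        then show "c i * u (n + M + d - i) = c i * u (n + d - i)" using later by metis
      qed
      also have "u (n + d + M) = u (n + d)" using later d by simp
      finally have "c d * u (n + M) = c d * u n" using split[OF n(1)] by simp
      then show "u (n + M) = u n" using cd by simp
    qed
  qed
  from this[of n0] show ?thesis using \<open>n \<ge> 1\<close> by simp
qed

lemma satisfies_rec_annihilated:
  assumes "satisfies_rec d c u"
  shows "\<exists>p::rat poly. p \<noteq> 0 \<and> (\<forall>n\<ge>1. shift_op p (\<lambda>n. of_int (u n)) n = 0)"
proof -
  define p :: "int poly" where "p = monom 1 d - (\<Sum>i=1..d. monom (c i) (d - i))"
  have rec: "u (n + d) = (\<Sum>i=1..d. c i * u (n + d - i))" if "n \<ge> 1" for n
    using assms that by (simp add: satisfies_rec_def)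
  have "(\<Sum>i=1..d. coeff (monom (c i) (d - i)) d) = 0" by (intro sum.neutral) auto
  then have "coeff p d = 1" by (simp add: p_def coeff_sum)
  then have "p \<noteq> 0" by auto
  moreover have "shift_op p u n = 0" if "n \<ge> 1" for n
  proof -
    have "(\<Sum>i=1..d. c i * u (n + (d - i))) = (\<Sum>i=1..d. c i * u (n + d - i))"
      by (intro sum.cong) auto
    then show ?thesis
      using rec[OF that] by (simp add: p_def shift_op_minus shift_op_sum shift_op_monom)
  qed
  ultimately show ?thesis
    using shift_op_of_int[of p u, where 'a = rat] by (intro exI[of _ "map_poly of_int p"]) simp
qed

theorem theorem1p2:
  fixes a b N :: nat and W :: "nat \<Rightarrow> int"
  assumes "a \<ge> 2" and "b \<ge> 2"
    and "mult_independent a b"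
    and "linear_recurrent W"
    and "\<And>n. n \<ge> 1 \<Longrightarrow> W n dvd int a ^ (n + N) - 1"
    and "\<And>n. n \<ge> 1 \<Longrightarrow> W n dvd int b ^ (n + N) - 1"
  shows "eventually_periodic W \<and>
    (linear_recurrent_nonzero_trailing W \<longrightarrow> periodic_from 1 W)"
proof -
  have sub: "subexponential_windows (\<lambda>n. of_int (W n))"
    unfolding subexponential_windows_def
  proof (intro allI impI)
    fix \<rho> :: real and r :: nat assume "\<rho> > 1"
    then show "\<exists>C. \<forall>n0. \<exists>n\<ge>n0. \<forall>k<r. cmod (of_int (W (n + k))) \<le> C * \<rho> ^ n"
      using small_values_on_windows[OF assms(1-3,5,6), of \<rho>] by (intro exI[of _ 1]) simp
  qed
  obtain p :: "rat poly" where p: "p \<noteq> 0" "\<And>n. n \<ge> 1 \<Longrightarrow> shift_op p (\<lambda>n. of_int (W n)) n = 0"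
    using assms(4) satisfies_rec_annihilated unfolding linear_recurrent_def by blast
  obtain M k n1 where M: "M \<ge> 1"
    and ann: "\<And>n. n \<ge> n1 \<Longrightarrow> shift_op ((monom 1 M - 1) ^ k) (\<lambda>n. rat_of_int (W n)) n = 0"
    using annihilated_by_power_of_X_power_minus_1[OF sub p(1), of 1 1] p(2) by auto
  have ann_int: "shift_op ((monom 1 M - 1) ^ k) W n = 0" if "n \<ge> n1" for n
  proof -
    have "map_poly of_int ((monom 1 M - 1) ^ k) = ((monom 1 M - 1) ^ k :: rat poly)"
      by (simp add: of_int_poly_hom.hom_power of_int_poly_hom.hom_minus)
    then show ?thesis
      using ann[OF that] shift_op_of_int[of "(monom 1 M - 1) ^ k" W n, where 'a = rat] by simp
  qed
  have "pcompose [:- 1, 1:] (monom 1 M) = (monom 1 M - 1 :: int poly)"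
    by (simp add: pcompose_pCons one_pCons)
  then have comp: "pcompose ([:- 1, 1:] ^ k) (monom 1 M) = (monom 1 M - 1 :: int poly) ^ k" for k
    by (induction k) (simp_all only: power_0 power_Suc pcompose_mult pcompose_1)
  define n0 where "n0 = max n1 1"
  have per: "W (n + M) = W n" if n: "n \<ge> n0" for n
  proof -
    define f where "f = (\<lambda>t. W (n + M * t))"
    have "shift_op ([:- 1, 1:] ^ k) f t = 0" for t
      using ann_int[of "n + M * t"] n shift_op_pcompose_monom[of "[:- 1, 1:] ^ k" M W n t]
      by (simp add: comp n0_def f_def)
    from newton_expansion[OF this]
    have "f 1 = f 0"
    proof (rule integer_valued_polynomial_dividing_powers_constant[OF _ assms(1) M, where m = "n + N"])
      fix t
      have "f t dvd int a ^ (n + M * t + N) - 1"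
        unfolding f_def using n by (intro assms(5)) (simp add: n0_def)
      then show dvd: "f t dvd int a ^ (n + N + M * t) - 1" by (simp add: ac_simps)
      have "n + N + M * t \<noteq> 0" using n by (simp add: n0_def)
      then have "int a ^ (n + N + M * t) > 1" using assms(1) by (intro one_less_power) auto
      then show "f t \<noteq> 0" using dvd by auto
    qed
    then show ?thesis by (simp add: f_def)
  qed
  have "eventually_periodic W"
    unfolding eventually_periodic_def periodic_from_def
    using M per by (intro exI[of _ n0] conjI exI[of _ M]) (auto simp: n0_def)
  moreover have "periodic_from 1 W" if trailing: "linear_recurrent_nonzero_trailing W"
  proof -
    obtain d c where dc: "satisfies_rec d c W" "c d \<noteq> 0"
      using trailing unfolding linear_recurrent_nonzero_trailing_def by blast
    have "W (n + M) = W n" if "n \<ge> 1" for n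
      by (rule periodic_from_start[OF dc, of n0 M n]) (fact per, fact that)
    then show ?thesis unfolding periodic_from_def using M by blast
  qed
  ultimately show ?thesis by blast
qed

end
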